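(* As $s \to \infty$, $R_\Delta(C_6, s) = \Theta(s^{3/2})$ and $R_\Delta(C_{10}, s) = \Theta(s^{5/4})$. That is, there are absolute constants $c, C > 0$ and an integer $s_0$ such that for all integers $s \ge s_0$, $c\, s^{3/2} \le R_\Delta(C_6, s) \le C s^{3/2}$ and $c\, s^{5/4} \le R_\Delta(C_{10}, s) \le C s^{5/4}$.
   Context: All graphs are finite and simple. $C_m$ is the cycle on $m$ vertices and $\Delta(H)$ is the maximum degree of $H$. For graphs $H, G$ and a positive integer $s$, write $H \xrightarrow{s} G$ if every coloring of the edges of $H$ with $s$ colors (an arbitrary map from $E(H)$ to a set of $s$ colors) contains a monochromatic subgraph isomorphic to $G$. The degree Ramsey number of $G$ is $R_\Delta(G,s) = \min\{\Delta(H) : H \xrightarrow{s} G\}$. *)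

theory Defs
  imports Complex_Main
begin

record 'a sgraph =
  vertices :: "'a set"
  edges :: "'a set set"

definition simple_graph :: "'a sgraph \<Rightarrow> bool" where
  "simple_graph G \<longleftrightarrow>
     finite (vertices G) \<and> (\<forall>e\<in>edges G. e \<subseteq> vertices G \<and> card e = 2)"

definition degree :: "'a sgraph \<Rightarrow> 'a \<Rightarrow> nat" where
  "degree G v = card {e \<in> edges G. v \<in> e}"

text \<open>Inserting 0 only matters for the graph without vertices, to which it gives maximum degree 0.\<close>

definition max_degree :: "'a sgraph \<Rightarrow> nat" where
  "max_degree G = Max (insert 0 (degree G ` vertices G))"

definition subgraph :: "'a sgraph \<Rightarrow> 'a sgraph \<Rightarrow> bool" where
  "subgraph K H \<longleftrightarrow>
     simple_graph K \<and> vertices K \<subseteq> vertices H \<and> edges K \<subseteq> edges H"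

definition isomorphic :: "'a sgraph \<Rightarrow> 'b sgraph \<Rightarrow> bool" where
  "isomorphic G H \<longleftrightarrow>
     (\<exists>\<phi>. bij_betw \<phi> (vertices G) (vertices H) \<and>
       (\<forall>u\<in>vertices G. \<forall>v\<in>vertices G. {u, v} \<in> edges G \<longleftrightarrow> {\<phi> u, \<phi> v} \<in> edges H))"

definition monochromatic :: "('a set \<Rightarrow> nat) \<Rightarrow> 'a sgraph \<Rightarrow> bool" where
  "monochromatic f K \<longleftrightarrow> (\<exists>c. \<forall>e\<in>edges K. f e = c)"

definition arrows :: "'a sgraph \<Rightarrow> nat \<Rightarrow> 'b sgraph \<Rightarrow> bool" where
  "arrows H s G \<longleftrightarrow>
     (\<forall>f. f ` edges H \<subseteq> {..<s} \<longrightarrow>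
        (\<exists>K. subgraph K H \<and> monochromatic f K \<and> isomorphic K G))"

text \<open>
  The host graph \<open>H\<close> ranges over finite simple graphs with vertices in \<open>nat\<close>; every finite graph
  is isomorphic to one of these. For a nonempty set of natural numbers \<open>Inf\<close> is the minimum.
  On the empty set it is 0, so a positive lower bound on \<open>degree_ramsey G s\<close> entails
  that some \<open>H\<close> with \<open>arrows H s G\<close> exists.
\<close>

definition degree_ramsey :: "'b sgraph \<Rightarrow> nat \<Rightarrow> nat" where
  "degree_ramsey G s =
     Inf {max_degree H | H :: nat sgraph. simple_graph H \<and> arrows H s G}"

text \<open>The cycle on \<open>m\<close> vertices, meaningful for \<open>m \<ge> 3\<close>.\<close>

definition cycle_graph :: "nat \<Rightarrow> nat sgraph" where
  "cycle_graph m =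
     \<lparr>vertices = {..<m}, edges = {{i, Suc i mod m} | i. i < m}\<rparr>"

lemma simple_graph_cycle_graph:
  assumes "m \<ge> 3"
  shows "simple_graph (cycle_graph m)"
proof -
  have "Suc i mod m < m \<and> i \<noteq> Suc i mod m" if "i < m" for i
    using that assms by (cases "Suc i = m") auto
  then show ?thesis
    by (auto simp: simple_graph_def cycle_graph_def card_2_iff)
qed

end

theory Submission
  imports Defs "HOL-Library.FuncSet" "HOL-Library.Z2" "HOL-Algebra.Algebraic_Closure_Type"
begin

text \<open>
  Upper bound: the host is \<open>K_{N,N}\<close> with \<open>N\<close> of order \<open>s^(k/(k-1))\<close>; its most frequent colour has
  more than \<open>c N^(1+1/k)\<close> edges and so contains \<open>C_{2k}\<close> (Bondy and Simonovits). In a breadth-first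
  search of a bipartite graph without \<open>C_{2k}\<close>, two consecutive layers \<open>L_i, L_{i+1}\<close> with \<open>i < k\<close>
  span only \<open>O(|L_i| + |L_{i+1}|)\<close> edges, so a large minimum degree forces \<open>|L_k|\<close> to exceed the
  number of vertices.

  Lower bound: Wenger's graphs decompose \<open>K_{n,n}\<close> into \<open>O(n^(1-1/k))\<close> subgraphs without
  non-backtracking closed walks of length \<open>2k\<close>, for \<open>k = 3, 5\<close>. A graph \<open>H\<close> of maximum degree \<open>D\<close> is
  mapped to \<open>K_{n,n}\<close>, with \<open>n = O(D)\<close>, so that all but a fraction of the edges at every vertex are
  mapped star-injectively; a monochromatic cycle formed by these edges would be mapped to a
  non-backtracking closed walk. The remaining edges have maximum degree at most \<open>7D/8\<close> and
  are coloured recursively with new colours, and the numbers of colours form a geometric series.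
\<close>

section \<open>Even cycles in bipartite graphs of large minimum degree\<close>

text \<open>The host \<open>H\<close> has bounded degree but any number of vertices, while the
  target has only O(D) vertices on each side. Injectivity on every neighbourhood may need about D^2
  colours, so it is required only for most edges at each vertex, and the local lemma supplies a
  colouring whatever the size of \<open>H\<close>. An edge \<open>x y\<close> is good when the
  colour of \<open>y\<close> is unique in \<open>N x\<close> and that of \<open>x\<close> is unique
  in \<open>N y\<close>. Failures of the first kind depend on many independent colours and are
  concentrated. Failures of the second kind, seen from \<open>x\<close>, hang on the single colour
  of \<open>x\<close>, so the chance that there are many is bounded only by a constant. Vertices
  spoilt in this way (\<open>heavy\<close>) cannot be excluded; they are made rare in every
  neighbourhood and recoloured. The vertex map is not injective, so a cycle is mapped to a mere
  closed walk; hence non-backtracking closed walks, and not only cycles, must be absent from the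
  target. The argument for this needs a value that occurs once in a cyclic sequence without adjacent
  repetitions. It works for lengths 3 and 5 and breaks at 4 with \<open>a, b, a, b\<close>.\<close>

definition has_cycle :: "('a \<Rightarrow> 'a \<Rightarrow> bool) \<Rightarrow> nat \<Rightarrow> bool" where
  "has_cycle R m \<longleftrightarrow> (\<exists>v. inj_on v {..<m} \<and> (\<forall>i<m. R (v i) (v (Suc i mod m))))"

lemma has_cycleI:
  assumes "distinct xs" "length xs = m" "m > 0" "successively R xs" "R (last xs) (hd xs)"
  shows "has_cycle R m"
  unfolding has_cycle_def
proof (intro exI conjI allI impI)
  show "inj_on ((!) xs) {..<m}"
    using assms by (auto simp: inj_on_def nth_eq_iff_index_eq)
next
  fix i assume "i < m"
  show "R (xs ! i) (xs ! (Suc i mod m))"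
  proof (cases "Suc i = m")
    case True
    then have "xs \<noteq> []" "i = length xs - 1" using assms by auto
    then have "xs ! i = last xs" "xs ! (Suc i mod m) = hd xs"
      using assms True by (auto simp: last_conv_nth hd_conv_nth)
    then show ?thesis using assms by simp
  next
    case False
    then show ?thesis
      using assms \<open>i < m\<close> by (simp add: successively_conv_nth)
  qed
qed

lemma successively_upt:
  assumes "\<And>r. a \<le> r \<Longrightarrow> Suc r < b \<Longrightarrow> P r (Suc r)"
  shows "successively P [a..<b]"
  using assms by (auto simp: successively_conv_nth)

lemma successively_const:
  assumes "successively R xs" "\<And>a b. R a b \<Longrightarrow> f a = f b" "xs \<noteq> []"
  shows "f (last xs) = f (hd xs)"
  using assms
proof (induction xs)
  case (Cons a xs)
  then show ?case by (cases xs) auto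
qed simp

text \<open>Greedy extension: a path with fewer than \<open>m\<close> vertices cannot contain all
  the neighbours of its last vertex.\<close>

lemma path_of_min_degree:
  assumes "finite S" "x \<in> S" "\<And>u. u \<in> S \<Longrightarrow> m \<le> card {v \<in> S. R u v}" "1 \<le> l" "l \<le> m"
  shows "\<exists>xs. distinct xs \<and> length xs = l \<and> hd xs = x \<and> set xs \<subseteq> S \<and> successively R xs"
  using assms(4,5)
proof (induction l rule: nat_induct_at_least)
  case base
  then show ?case using assms(2) by (intro exI[of _ "[x]"]) auto
next
  case (Suc l)
  then obtain xs where xs: "distinct xs" "length xs = l" "hd xs = x" "set xs \<subseteq> S" "successively R xs"
    by auto
  have ne: "xs \<noteq> []" using xs Suc by auto
  have "\<not> {v \<in> S. R (last xs) v} \<subseteq> set xs"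
  proof
    assume "{v \<in> S. R (last xs) v} \<subseteq> set xs"
    then have "card {v \<in> S. R (last xs) v} \<le> l"
      using card_mono[OF finite_set] distinct_card[OF xs(1)] xs(2) by metis
    moreover have "m \<le> card {v \<in> S. R (last xs) v}"
      using assms(3) xs(4) ne last_in_set by blast
    ultimately show False using Suc.prems by simp
  qed
  then obtain v where v: "v \<in> S" "R (last xs) v" "v \<notin> set xs" by auto
  show ?case
    using xs v ne by (intro exI[of _ "xs @ [v]"]) (auto simp: successively_append_iff)
qed

text \<open>Deleting a vertex with fewer than \<open>d\<close> neighbours lowers the degree sum by
  less than \<open>2 * d\<close>. The hypothesis therefore survives, and survives strictly, so the
  deletions stop before the set is empty.\<close>

lemma min_degree_subgraph:
  assumes "finite V" "V \<noteq> {}" "\<And>u v. R u v \<Longrightarrow> R v u"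
    and "2 * d * card V \<le> (\<Sum>u\<in>V. card {v \<in> V. R u v})"
  shows "\<exists>S\<subseteq>V. S \<noteq> {} \<and> (\<forall>u\<in>S. d \<le> card {v \<in> S. R u v})"
  using assms(1,2,4)
proof (induction V rule: finite_psubset_induct)
  case (psubset V)
  show ?case
  proof (cases "\<forall>u\<in>V. d \<le> card {v \<in> V. R u v}")
    case True
    then show ?thesis using psubset by blast
  next
    case False
    then obtain u where u: "u \<in> V" "card {v \<in> V. R u v} < d" by auto
    define W where "W = V - {u}"
    have fW: "finite W" "u \<notin> W" and V: "V = insert u W"
      using psubset u by (auto simp: W_def)
    have 1: "card {v \<in> V. R x v} = card {v \<in> W. R x v} + (if R x u then 1 else 0)" for x
    proof -
      have "{v \<in> V. R x v} = (if R x u then insert u {v \<in> W. R x v} else {v \<in> W. R x v})"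
        using V by auto
      then show ?thesis using fW by simp
    qed
    have "(\<Sum>x\<in>W. if R x u then 1 else 0) = card {x \<in> W. R x u}"
      using fW by (simp add: sum.If_cases Int_def)
    also have "{x \<in> W. R x u} = {x \<in> W. R u x}"
      using assms(3) by auto
    also have "card \<dots> \<le> card {v \<in> V. R u v}"
      using psubset V by (intro card_mono) auto
    finally have 2: "(\<Sum>x\<in>W. if R x u then 1 else 0) < d" using u by simp
    have "(\<Sum>x\<in>V. card {v \<in> V. R x v}) = card {v \<in> V. R u v} + (\<Sum>x\<in>W. card {v \<in> V. R x v})"
      using V fW by simp
    also have "(\<Sum>x\<in>W. card {v \<in> V. R x v}) =
        (\<Sum>x\<in>W. card {v \<in> W. R x v}) + (\<Sum>x\<in>W. if R x u then 1 else 0)"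
      by (simp add: 1 sum.distrib)
    finally have 3: "2 * d * card V < (\<Sum>x\<in>W. card {v \<in> W. R x v}) + 2 * d"
      using psubset.prems u 2 by linarith
    have "card V = Suc (card W)" using V fW by simp
    then have 4: "2 * d * card W < (\<Sum>x\<in>W. card {v \<in> W. R x v})" using 3 by simp
    then have "W \<noteq> {}" by auto
    moreover have "W \<subset> V" using V fW by auto
    ultimately have "\<exists>S\<subseteq>W. S \<noteq> {} \<and> (\<forall>u\<in>S. d \<le> card {v \<in> S. R u v})"
      using psubset.IH[of W] 4 by simp
    then show ?thesis using \<open>W \<subset> V\<close> by blast
  qed
qed

text \<open>Descend from the root, at each level dropping at most \<open>r\<close> vertices outside one child.\<close>

lemma robust_ancestor:
  fixes par :: "'a \<Rightarrow> 'a"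
  assumes "finite N" "r * i + 1 < card N" "\<And>y. y \<in> N \<Longrightarrow> (par ^^ i) y = x"
  shows "\<exists>j N' z. 1 \<le> j \<and> j \<le> i \<and> N' \<subseteq> N \<and> card N \<le> card N' + r * i \<and>
    (\<forall>y\<in>N'. (par ^^ j) y = z) \<and> (\<forall>c. r < card {y \<in> N'. (par ^^ (j - 1)) y \<noteq> c})"
  using assms
proof (induction i arbitrary: N x)
  case 0
  then have "N \<subseteq> {x}" by auto
  then have "card N \<le> 1" using card_mono[of "{x}" N] by simp
  then show ?case using 0 by simp
next
  case (Suc i)
  show ?case
  proof (cases "\<forall>c. r < card {y \<in> N. (par ^^ i) y \<noteq> c}")
    case True
    then show ?thesis
      using Suc.prems by (intro exI[of _ "Suc i"] exI[of _ N] exI[of _ x]) auto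
  next
    case False
    then obtain c where c: "card {y \<in> N. (par ^^ i) y \<noteq> c} \<le> r" by (auto simp: not_less)
    define M where "M = {y \<in> N. (par ^^ i) y = c}"
    have "card N = card (M \<union> {y \<in> N. (par ^^ i) y \<noteq> c})"
      by (rule arg_cong[where f = card]) (auto simp: M_def)
    then have cM: "card N \<le> card M + r"
      using c card_Un_le[of M "{y \<in> N. (par ^^ i) y \<noteq> c}"] by linarith
    have "\<exists>j N' z. 1 \<le> j \<and> j \<le> i \<and> N' \<subseteq> M \<and> card M \<le> card N' + r * i \<and>
      (\<forall>y\<in>N'. (par ^^ j) y = z) \<and> (\<forall>c. r < card {y \<in> N'. (par ^^ (j - 1)) y \<noteq> c})"
    proof (rule Suc.IH)
      show "finite M" using Suc.prems by (auto simp: M_def)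
      show "r * i + 1 < card M" using cM Suc.prems(2) by simp
    qed (auto simp: M_def)
    then obtain j N' z where *: "1 \<le> j" "j \<le> i" "N' \<subseteq> M" "card M \<le> card N' + r * i"
      "\<forall>y\<in>N'. (par ^^ j) y = z" "\<forall>c. r < card {y \<in> N'. (par ^^ (j - 1)) y \<noteq> c}"
      by blast
    show ?thesis
      using * cM M_def by (intro exI[of _ j] exI[of _ N'] exI[of _ z]) auto
  qed
qed

text \<open>The cycle follows \<open>P\<close> from \<open>y\<close> to \<open>y'\<close>, climbs
  \<open>j\<close> steps to the common ancestor and descends through \<open>j - 1\<close> further
  vertices towards \<open>y\<close>. Tree vertices have level below \<open>i\<close> and so avoid
  \<open>P\<close>. The two branches stay apart below the ancestor: meeting earlier, they would
  agree at height \<open>j - 1\<close>.\<close>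

lemma close_path_through_tree:
  fixes par :: "'a \<Rightarrow> 'a" and lev :: "'a \<Rightarrow> nat"
  assumes sym: "\<And>u v. R u v \<Longrightarrow> R v u"
    and tree: "\<And>y r. y \<in> A \<Longrightarrow> r < i \<Longrightarrow> R ((par ^^ r) y) ((par ^^ Suc r) y)"
    and lev: "\<And>y r. y \<in> A \<Longrightarrow> r \<le> i \<Longrightarrow> lev ((par ^^ r) y) = i - r"
    and P: "distinct P" "successively R P" "\<And>v. v \<in> set P \<Longrightarrow> i \<le> lev v"
      "length P = 2 * m + 1" "hd P = y" "last P = y'" "y \<in> A" "y' \<in> A"
    and j: "1 \<le> j" "j \<le> i" "(par ^^ j) y = (par ^^ j) y'" "(par ^^ (j - 1)) y \<noteq> (par ^^ (j - 1)) y'"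
  shows "has_cycle R (2 * m + 2 * j)"
proof -
  define us where "us = map (\<lambda>r. (par ^^ r) y') [1..<Suc j]"
  define ds where "ds = map (\<lambda>r. (par ^^ r) y) (rev [1..<j])"
  have ne: "P \<noteq> []" "us \<noteq> []" using P j by (auto simp: us_def)
  have hus: "hd us = par y'"
    using j by (simp add: us_def hd_map del: upt_Suc)
  have lus: "last us = (par ^^ j) y"
    using j by (simp add: us_def last_map)
  have hds: "hd ds = (par ^^ (j - 1)) y" if "j \<noteq> 1"
    using j that by (simp add: ds_def hd_map hd_rev last_upt)
  have lds: "last (us @ ds) = par y"
  proof (cases "j = 1")
    case True
    then show ?thesis using lus by (simp add: ds_def)
  next
    case False
    then show ?thesis using j by (simp add: ds_def last_map last_rev)
  qed
  have inj: "inj_on (\<lambda>r. (par ^^ r) v) {1..j}" if "v \<in> A" for v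
  proof (rule inj_onI)
    fix a b assume "a \<in> {1..j}" "b \<in> {1..j}" "(par ^^ a) v = (par ^^ b) v"
    then have "i - a = i - b" using lev[OF that, of a] lev[OF that, of b] j by simp
    then show "a = b" using \<open>a \<in> _\<close> \<open>b \<in> _\<close> j by auto
  qed
  have disj: "(par ^^ a) y' \<noteq> (par ^^ b) y" if "1 \<le> a" "a \<le> j" "1 \<le> b" "b < j" for a b
  proof
    assume eq: "(par ^^ a) y' = (par ^^ b) y"
    then have "i - a = i - b" using lev[OF P(8), of a] lev[OF P(7), of b] j that by simp
    then have "a = b" using j that by auto
    have "(par ^^ (j - 1)) v = (par ^^ (j - 1 - b)) ((par ^^ b) v)" for v
      using that by (subst funpow_add[symmetric, THEN fun_cong, unfolded comp_def]) simp
    then show False using eq \<open>a = b\<close> j by metis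
  qed
  have low: "lev v < i" if "v \<in> set us \<union> set ds" for v
    using that lev[OF P(7)] lev[OF P(8)] j by (auto simp: us_def ds_def)
  have "distinct (P @ us @ ds)"
  proof -
    have "distinct us" using inj[OF P(8)]
      by (auto simp: us_def distinct_map simp del: upt_Suc intro: inj_on_subset)
    moreover have "distinct ds" using inj[OF P(7)]
      by (auto simp: ds_def distinct_map simp del: upt_Suc intro: inj_on_subset)
    moreover have "set us \<inter> set ds = {}"
      using disj by (force simp: us_def ds_def simp del: upt_Suc)
    moreover have "set P \<inter> (set us \<union> set ds) = {}"
      using low P(3) by force
    ultimately show ?thesis using P(1) by auto
  qed
  moreover have "length (P @ us @ ds) = 2 * m + 2 * j"
    using P(4) j by (simp add: us_def ds_def)
  moreover have "successively R (P @ us @ ds)"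
  proof -
    have "successively R us" unfolding us_def successively_map
      by (rule successively_upt) (use tree[OF P(8)] j in auto)
    moreover have "successively R ds" unfolding ds_def successively_map successively_rev
      by (rule successively_upt) (use tree[OF P(7)] sym j in auto)
    moreover have "R (last P) (hd us)"
      using hus P(6) tree[OF P(8), of 0] j by simp
    moreover have "R (last us) (hd ds)" if "ds \<noteq> []"
    proof -
      have "j \<noteq> 1" using that by (auto simp: ds_def)
      then show ?thesis
        using hds lus sym[OF tree[OF P(7), of "j - 1"]] j by simp
    qed
    ultimately show ?thesis using P(2) ne
      by (auto simp: successively_append_iff)
  qed
  moreover have "R (last (P @ us @ ds)) (hd (P @ us @ ds))"
    using lds ne P(5) sym[OF tree[OF P(7), of 0]] j by simp
  ultimately show ?thesis
    by (intro has_cycleI[of "P @ us @ ds"]) (use j in auto)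
qed

text \<open>
  Let \<open>w\<close> be the last vertex in \<open>B\<close> of a path starting at \<open>y \<in> A\<close>. Robustness allows the final step
  from \<open>w\<close> to leave the path and to enter another branch than that of \<open>y\<close> below the common ancestor.
  Only this step uses the full set \<open>M w\<close>, so the other vertices may be restricted to a subgraph
  of large minimum degree.
\<close>

lemma layer_edges_le:
  fixes par :: "'a \<Rightarrow> 'a" and lev :: "'a \<Rightarrow> nat"
  assumes sym: "\<And>u v. R u v \<Longrightarrow> R v u"
    and fin: "finite A" "finite B"
    and i: "1 \<le> i" "i < k"
    and root: "\<And>y. y \<in> A \<Longrightarrow> (par ^^ i) y = x"
    and tree: "\<And>y r. y \<in> A \<Longrightarrow> r < i \<Longrightarrow> R ((par ^^ r) y) ((par ^^ Suc r) y)"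
    and lev: "\<And>y r. y \<in> A \<Longrightarrow> r \<le> i \<Longrightarrow> lev ((par ^^ r) y) = i - r"
    and levB: "\<And>w. w \<in> B \<Longrightarrow> lev w = Suc i"
    and nocyc: "\<not> has_cycle R (2 * k)"
  shows "(\<Sum>w\<in>B. card {y \<in> A. R w y}) \<le> (4 * k * k + 1) * (card A + card B)"
proof (rule ccontr)
  assume contr: "\<not> ?thesis"
  have levA: "lev y = i" if "y \<in> A" for y using lev[OF that, of 0] by simp
  have disj: "A \<inter> B = {}" using levA levB by force
  define N where "N w = {y \<in> A. R w y}" for w
  \<comment> \<open>The bound is what \<open>robust_ancestor\<close> asks for when \<open>r\<close>
    is \<open>2 * k\<close>. Vertices of \<open>B\<close> below it contribute at most
    \<open>2 * k * i + 1\<close> edges each.\<close>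
  define W where "W = {w \<in> B. 2 * k * i + 1 < card (N w)}"
  have finW: "finite W" using fin by (auto simp: W_def)
  have finN: "finite (N w)" for w using fin by (auto simp: N_def)
  define G where "G w j N' z \<longleftrightarrow> 1 \<le> j \<and> j \<le> i \<and> N' \<subseteq> N w \<and>
    card (N w) \<le> card N' + 2 * k * i \<and> (\<forall>y\<in>N'. (par ^^ j) y = z) \<and>
    (\<forall>c. 2 * k < card {y \<in> N'. (par ^^ (j - 1)) y \<noteq> c})" for w j N' z
  have "\<forall>w\<in>W. \<exists>j N' z. G w j N' z"
    unfolding G_def
    by (intro ballI robust_ancestor[where x = x]) (use finN root in \<open>auto simp: W_def N_def\<close>)
  then obtain J M Z where "\<And>w. w \<in> W \<Longrightarrow> G w (J w) (M w) (Z w)" by metis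
  then have JMZ: "w \<in> W \<Longrightarrow> 1 \<le> J w \<and> J w \<le> i \<and> M w \<subseteq> N w \<and>
    card (N w) \<le> card (M w) + 2 * k * i \<and> (\<forall>y\<in>M w. (par ^^ J w) y = Z w) \<and>
    (\<forall>c. 2 * k < card {y \<in> M w. (par ^^ (J w - 1)) y \<noteq> c})" for w
    unfolding G_def .
  define E where "E j = (\<Sum>w | w \<in> W \<and> J w = j. card (M w))" for j
  \<comment> \<open>Pigeonhole: the height \<open>j\<close> fixes the length of the path to be
    found, so all vertices of \<open>B\<close> on the path must have their ancestor at the same
    height.\<close>
  have "\<exists>j\<in>{1..i}. 2 * k * (card A + card B) < E j"
  proof (rule ccontr)
    assume "\<not> ?thesis"
    then have E: "E j \<le> 2 * k * (card A + card B)" if "j \<in> {1..i}" for j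
      using that by (auto simp: not_less)
    have "(\<Sum>w\<in>B. card {y \<in> A. R w y}) \<le>
        (\<Sum>w\<in>B. (if w \<in> W then card (M w) else 0) + (2 * k * i + 1))"
    proof (rule sum_mono)
      fix w assume "w \<in> B"
      then show "card {y \<in> A. R w y} \<le> (if w \<in> W then card (M w) else 0) + (2 * k * i + 1)"
        using JMZ[of w] by (auto simp: W_def N_def not_less)
    qed
    also have "\<dots> = (\<Sum>w\<in>W. card (M w)) + card B * (2 * k * i + 1)"
    proof -
      have "B \<inter> W = W" by (auto simp: W_def)
      then show ?thesis
        unfolding sum.distrib using fin by (simp add: sum.inter_restrict[symmetric])
    qed
    also have "(\<Sum>w\<in>W. card (M w)) = (\<Sum>j\<in>{1..i}. E j)"
      unfolding E_def by (rule sum.group[symmetric]) (use finW JMZ in auto)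
    also have "\<dots> \<le> (\<Sum>j\<in>{1..i}. 2 * k * (card A + card B))"
      using E by (rule sum_mono)
    also have "\<dots> = i * (2 * k * (card A + card B))" by simp
    also have "\<dots> \<le> k * (2 * k * (card A + card B))"
      using i by (intro mult_right_mono) auto
    finally have 1: "(\<Sum>w\<in>B. card {y \<in> A. R w y}) \<le>
      k * (2 * k * (card A + card B)) + card B * (2 * k * i + 1)" by simp
    have "card B * (2 * k * i + 1) \<le> (card A + card B) * (2 * k * k + 1)"
      using i by (intro mult_mono add_mono) auto
    then have "(\<Sum>w\<in>B. card {y \<in> A. R w y}) \<le>
      k * (2 * k * (card A + card B)) + (card A + card B) * (2 * k * k + 1)" using 1 by linarith
    also have "\<dots> = (4 * k * k + 1) * (card A + card B)" by (simp add: algebra_simps)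
    finally show False using contr by simp
  qed
  then obtain j where j: "1 \<le> j" "j \<le> i" "2 * k * (card A + card B) < E j" by auto
  define Wj where "Wj = {w \<in> W. J w = j}"
  have Wj: "finite Wj" "Wj \<subseteq> B" "Wj \<subseteq> W"
    using finite_subset[OF _ finW, of Wj] by (auto simp: Wj_def W_def)
  have MA: "M w \<subseteq> A" if "w \<in> Wj" for w using JMZ[of w] that by (auto simp: Wj_def N_def)
  define Q where "Q u v \<longleftrightarrow> (u \<in> Wj \<and> v \<in> M u) \<or> (v \<in> Wj \<and> u \<in> M v)" for u v
  have Qsym: "Q u v \<Longrightarrow> Q v u" for u v by (auto simp: Q_def)
  have QAB: "(u \<in> A \<longleftrightarrow> v \<in> B) \<and> (u \<in> B \<longleftrightarrow> v \<in> A)" if "Q u v" for u v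
    using that MA Wj disj unfolding Q_def by blast
  have QR: "R u v" if "Q u v" for u v
  proof -
    have "y \<in> M w \<Longrightarrow> R w y" if "w \<in> Wj" for w y
      using JMZ[of w] that by (auto simp: N_def Wj_def)
    then show ?thesis using that sym unfolding Q_def by blast
  qed
  have "\<exists>S\<subseteq>A \<union> B. S \<noteq> {} \<and> (\<forall>u\<in>S. 2 * k \<le> card {v \<in> S. Q u v})"
  proof (rule min_degree_subgraph)
    show "finite (A \<union> B)" using fin by simp
    show "A \<union> B \<noteq> {}"
    proof
      assume "A \<union> B = {}"
      then show False using j(3) Wj by (auto simp: E_def W_def)
    qed
    have 1: "(\<Sum>u\<in>Wj. card {v \<in> A \<union> B. Q u v}) = E j"
      unfolding E_def Wj_def[symmetric]
    proof (rule sum.cong)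
      fix u assume "u \<in> Wj"
      then have "{v \<in> A \<union> B. Q u v} = M u"
        using MA Wj(2) disj unfolding Q_def by blast
      then show "card {v \<in> A \<union> B. Q u v} = card (M u)" by simp
    qed simp
    have 2: "(\<Sum>u\<in>A. card {v \<in> A \<union> B. Q u v}) = (\<Sum>u\<in>A. card {v \<in> Wj. u \<in> M v})"
    proof (rule sum.cong)
      fix u assume "u \<in> A"
      then have "{v \<in> A \<union> B. Q u v} = {v \<in> Wj. u \<in> M v}"
        using MA Wj(2) disj unfolding Q_def by blast
      then show "card {v \<in> A \<union> B. Q u v} = card {v \<in> Wj. u \<in> M v}" by simp
    qed simp
    have "(\<Sum>u\<in>A. card {v \<in> Wj. u \<in> M v}) = (\<Sum>v\<in>Wj. card {u \<in> A. u \<in> M v})"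
      by (rule sum_multicount_gen) (use fin Wj in auto)
    also have "\<dots> = E j"
      unfolding E_def Wj_def[symmetric]
      by (rule sum.cong) (use MA in \<open>auto intro!: arg_cong[where f = card]\<close>)
    finally have 3: "(\<Sum>u\<in>A. card {v \<in> A \<union> B. Q u v}) = E j" using 2 by simp
    have "2 * (2 * k) * card (A \<union> B) \<le> 2 * E j"
      using j(3) fin disj by (simp add: card_Un_disjoint)
    also have "\<dots> = (\<Sum>u\<in>A \<union> Wj. card {v \<in> A \<union> B. Q u v})"
      using 1 3 by (subst sum.union_disjoint) (use fin Wj disj in auto)
    also have "\<dots> \<le> (\<Sum>u\<in>A \<union> B. card {v \<in> A \<union> B. Q u v})"
      by (rule sum_mono2) (use fin Wj in auto)
    finally show "2 * (2 * k) * card (A \<union> B) \<le> (\<Sum>u\<in>A \<union> B. card {v \<in> A \<union> B. Q u v})" .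
  qed (use Qsym in auto)
  then obtain S where S: "S \<subseteq> A \<union> B" "S \<noteq> {}" "\<And>u. u \<in> S \<Longrightarrow> 2 * k \<le> card {v \<in> S. Q u v}"
    by auto
  have finS: "finite S" using S fin finite_subset by blast
  have nbr: "\<exists>v\<in>S. Q u v" if "u \<in> S" for u
  proof (rule ccontr)
    assume "\<not> ?thesis"
    then have "{v \<in> S. Q u v} = {}" by auto
    then show False using S(3)[OF that] i by (metis card.empty le_zero_eq mult_is_0 not_less_zero zero_neq_numeral)
  qed
  obtain y where y: "y \<in> S" "y \<in> A"
  proof -
    obtain u where u: "u \<in> S" using S(2) by auto
    obtain v where "v \<in> S" "Q u v" using nbr[OF u] by auto
    then show ?thesis using that u S(1) QAB by blast
  qed
  \<comment> \<open>A path on \<open>2 * m\<close> vertices, extended by \<open>y'\<close>, together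
    with \<open>2 * j - 1\<close> tree vertices closes up to length \<open>2 * k\<close>.\<close>
  define m where "m = k - j"
  have m: "1 \<le> m" "m + j = k" using j i by (auto simp: m_def)
  obtain xs where xs: "distinct xs" "length xs = 2 * m" "hd xs = y" "set xs \<subseteq> S" "successively Q xs"
    using path_of_min_degree[where R = Q and m = "2 * k" and l = "2 * m", OF finS y(1) S(3)] m by auto
  have ne: "xs \<noteq> []" using xs m by auto
  have alt: "p < length xs \<Longrightarrow> (if even p then xs ! p \<in> A else xs ! p \<in> B)" for p
  proof (induction p)
    case 0
    then show ?case using xs y ne by (simp add: hd_conv_nth[symmetric])
  next
    case (Suc p)
    have "Q (xs ! p) (xs ! Suc p)" using xs(5) Suc.prems by (simp add: successively_conv_nth)
    then show ?case using Suc QAB[of "xs ! p" "xs ! Suc p"] by (auto split: if_splits)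
  qed
  define w where "w = last xs"
  have "w \<in> B" using alt[of "length xs - 1"] ne xs(2) m by (simp add: w_def last_conv_nth)
  moreover have "w \<in> S" using ne xs by (auto simp: w_def)
  ultimately have w: "w \<in> Wj" using nbr[of w] MA disj by (auto simp: Q_def)
  have Jw: "J w = j" "w \<in> W" using w by (auto simp: Wj_def)
  have "\<not> {z \<in> M w. (par ^^ (j - 1)) z \<noteq> (par ^^ (j - 1)) y} \<subseteq> set xs"
  proof
    assume "{z \<in> M w. (par ^^ (j - 1)) z \<noteq> (par ^^ (j - 1)) y} \<subseteq> set xs"
    then have "card {z \<in> M w. (par ^^ (j - 1)) z \<noteq> (par ^^ (j - 1)) y} \<le> 2 * m"
      using card_mono[OF finite_set] distinct_card[OF xs(1)] xs(2) by metis
    moreover have "2 * k < card {z \<in> M w. (par ^^ (j - 1)) z \<noteq> (par ^^ (j - 1)) y}"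
      using JMZ[OF Jw(2)] Jw by simp
    ultimately show False using m by simp
  qed
  then obtain y' where y': "y' \<in> M w" "(par ^^ (j - 1)) y' \<noteq> (par ^^ (j - 1)) y" "y' \<notin> set xs"
    by auto
  have y'A: "y' \<in> A" using MA w y' by auto
  define P where "P = xs @ [y']"
  have succ: "successively Q P"
    using xs y' w ne by (auto simp: P_def successively_append_iff Q_def w_def)
  \<comment> \<open>A \<open>Q\<close>-edge joins some \<open>w\<close> to a vertex whose
    \<open>j\<close>-th ancestor is \<open>Z w\<close>. So \<open>f\<close> is constant along
    \<open>Q\<close>-paths, and both ends of \<open>P\<close> have the same \<open>j\<close>-th
    ancestor.\<close>
  define f where "f v = (if v \<in> A then (par ^^ j) v else Z v)" for v
  have "f v = f u" if "u \<in> Wj" "v \<in> M u" for u v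
    using JMZ[of u] MA[of u] that Wj(2) disj by (auto simp: f_def Wj_def)
  then have "f a = f b" if "Q a b" for a b
    using that unfolding Q_def by metis
  from successively_const[OF succ this] have "f y' = f y"
    using xs ne by (simp add: P_def)
  then have eq: "(par ^^ j) y' = (par ^^ j) y" using y y'A by (simp add: f_def)
  have "has_cycle R (2 * m + 2 * j)"
  proof (rule close_path_through_tree[where A = A and i = i and par = par and lev = lev
        and y = y and y' = y'])
    show "distinct P" using xs y' by (simp add: P_def)
    show "successively R P" using succ QR by (rule successively_mono)
    show "i \<le> lev v" if "v \<in> set P" for v
      using that S xs y'A levA levB by (fastforce simp: P_def)
  qed (use sym tree lev xs y y' y'A ne eq j in \<open>auto simp: P_def\<close>)
  then show False using nocyc m by (simp add: distrib_left[symmetric])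
qed

text \<open>With c for \<open>4 * k * k + 1\<close>, the degree condition and the layer bound give
  \<open>(b + 3) * card (L n) \<le> 2 * card (L n) + card (L (n - 1)) + card (L (n + 1))\<close> for
  positive \<open>n\<close>. As layers do not shrink, the 3 absorbs all but the last term and each
  layer is at least \<open>b\<close> times as large as the one before.\<close>

lemma even_cycle_of_min_degree:
  assumes fin: "finite V" "x \<in> V"
    and RV: "\<And>u v. R u v \<Longrightarrow> u \<in> V \<and> v \<in> V"
    and sym: "\<And>u v. R u v \<Longrightarrow> R v u"
    and side: "\<And>u v. R u v \<Longrightarrow> side u \<noteq> (side v :: bool)"
    and deg: "\<And>u. u \<in> V \<Longrightarrow> (4 * k * k + 1) * (b + 3) \<le> card {v \<in> V. R u v}"
    and k: "k \<ge> 1" and b: "b \<ge> 1" "card V < b ^ k"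
  shows "has_cycle R (2 * k)"
proof (rule ccontr)
  assume nocyc: "\<not> has_cycle R (2 * k)"
  define c where "c = 4 * k * k + 1"
  define reach where "reach v \<longleftrightarrow> (\<exists>n. (R ^^ n) x v)" for v
  define lev where "lev v = (LEAST n. (R ^^ n) x v)" for v
  have lev_le: "lev v \<le> n" if "(R ^^ n) x v" for n v
    unfolding lev_def using that by (rule Least_le)
  have reach_lev: "(R ^^ lev v) x v" if "reach v" for v
    using that unfolding lev_def reach_def by (rule LeastI_ex)
  have step: "reach v \<and> lev v \<le> Suc (lev u)" if "reach u" "R u v" for u v
  proof -
    have "(R ^^ Suc (lev u)) x v" using reach_lev[OF that(1)] that(2) by (rule relpowp_Suc_I)
    then show ?thesis using lev_le[of "Suc (lev u)" v] unfolding reach_def by blast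
  qed
  have par: "(R ^^ n) x v \<Longrightarrow> side v = (if even n then side x else \<not> side x)" for n v
  proof (induction n arbitrary: v)
    case (Suc n)
    then show ?case using side by (force simp: relcompp_apply)
  qed auto
  define L where "L n = {v \<in> V. reach v \<and> lev v = n}" for n
  have finL: "finite (L n)" for n using fin by (auto simp: L_def)
  have L0: "L 0 = {x}"
  proof -
    have "reach x" "lev x = 0" using lev_le[of 0 x] by (auto simp: reach_def intro: exI[of _ 0])
    moreover have "v = x" if "reach v" "lev v = 0" for v using reach_lev[OF that(1)] that by simp
    ultimately show ?thesis unfolding L_def using fin(2) by blast
  qed
  have down: "\<exists>u\<in>L n. R v u" if "v \<in> L (Suc n)" for v n
  proof -
    have "(R ^^ Suc n) x v" using that reach_lev by (force simp: L_def)
    then obtain u where u: "(R ^^ n) x u" "R u v" by (auto simp: relcompp_apply)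
    then have "reach u" by (auto simp: reach_def)
    moreover have "lev u = n" using lev_le[OF u(1)] step[OF \<open>reach u\<close> u(2)] that by (auto simp: L_def)
    ultimately show ?thesis using RV[OF u(2)] sym[OF u(2)] unfolding L_def by blast
  qed
  \<comment> \<open>At the root, and at vertices that are not reached, this choice is arbitrary;
    \<open>p\<close> is iterated at most \<open>n\<close> times from layer \<open>n\<close>.\<close>
  define p where "p v = (SOME u. u \<in> L (lev v - 1) \<and> R v u)" for v
  have p: "p v \<in> L n" "R v (p v)" if "v \<in> L (Suc n)" for v n
  proof -
    have "lev v = Suc n" using that by (simp add: L_def)
    then have "p v \<in> L n \<and> R v (p v)"
      using someI_ex[of "\<lambda>u. u \<in> L n \<and> R v u"] down[OF that] by (auto simp: p_def)
    then show "p v \<in> L n" "R v (p v)" by auto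
  qed
  have anc: "r \<le> n \<Longrightarrow> v \<in> L n \<Longrightarrow> (p ^^ r) v \<in> L (n - r)" for r n v
  proof (induction r)
    case (Suc r)
    then have "(p ^^ r) v \<in> L (Suc (n - Suc r))" by (simp add: Suc_diff_Suc)
    then show ?case using p(1) by simp
  qed simp
  have nbrs: "v \<in> L (Suc n) \<or> (\<exists>n'. n = Suc n' \<and> v \<in> L n')" if "u \<in> L n" "R u v" for u v n
  proof -
    have u: "reach u" "lev u = n" using that by (auto simp: L_def)
    have v: "reach v" "lev v \<le> Suc n" using step[OF u(1) that(2)] u by auto
    have "n \<le> Suc (lev v)" using step[OF v(1) sym[OF that(2)]] u by simp
    \<comment> \<open>Bipartiteness enters here: the parity of the level determines the side, so no
      edge lies inside a layer.\<close>
    moreover have "lev v \<noteq> n"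
      using par[OF reach_lev[OF u(1)]] par[OF reach_lev[OF v(1)]] u side[OF that(2)] by auto
    ultimately have "lev v = Suc n \<or> n = Suc (lev v)" using v by linarith
    then show ?thesis using v RV[OF that(2)] by (auto simp: L_def)
  qed
  define e where "e n = (\<Sum>w\<in>L (Suc n). card {y \<in> L n. R w y})" for n
  have e: "e n \<le> c * (card (L n) + card (L (Suc n)))" if "n < k" for n
  proof (cases "n = 0")
    \<comment> \<open>\<open>layer_edges_le\<close> starts at layer 1. Below it there is only the
      root, which gives at most one edge to each vertex.\<close>
    case True
    have "e n \<le> (\<Sum>w\<in>L (Suc n). 1)" unfolding e_def
    proof (rule sum_mono)
      fix w
      have "card {y \<in> L n. R w y} \<le> card (L n)" using finL by (intro card_mono) auto
      then show "card {y \<in> L n. R w y} \<le> 1" using True L0 by simp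
    qed
    also have "\<dots> \<le> c * (card (L n) + card (L (Suc n)))" by (simp add: c_def)
    finally show ?thesis .
  next
    case False
    show ?thesis unfolding e_def c_def
    proof (rule layer_edges_le[where par = p and lev = lev and i = n and x = x])
      show "(p ^^ n) y = x" if "y \<in> L n" for y using anc[of n n y] that L0 by simp
      show "R ((p ^^ r) y) ((p ^^ Suc r) y)" if "y \<in> L n" "r < n" for y r
      proof -
        have "(p ^^ r) y \<in> L (Suc (n - Suc r))" using anc[of r n y] that by (simp add: Suc_diff_Suc)
        then show ?thesis using p(2) by simp
      qed
      show "lev ((p ^^ r) y) = n - r" if "y \<in> L n" "r \<le> n" for y r
        using anc[of r n y] that by (simp add: L_def)
    qed (use sym finL False that nocyc in \<open>auto simp: L_def\<close>)
  qed
  have up: "(\<Sum>y\<in>L n. card {v \<in> L (Suc n). R y v}) = e n" for n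
  proof -
    have "(\<Sum>y\<in>L n. card {v \<in> L (Suc n). R y v}) = (\<Sum>v\<in>L (Suc n). card {y \<in> L n. R y v})"
      by (rule sum_multicount_gen) (use finL in auto)
    also have "\<dots> = e n" unfolding e_def
      using sym by (intro sum.cong arg_cong[where f = card]) auto
    finally show ?thesis .
  qed
  have degsum: "c * (b + 3) * card (L n) \<le> e n + (case n of 0 \<Rightarrow> 0 | Suc n' \<Rightarrow> e n')" for n
  proof -
    have "c * (b + 3) * card (L n) = (\<Sum>y\<in>L n. c * (b + 3))" by simp
    also have "\<dots> \<le> (\<Sum>y\<in>L n. card {v \<in> L (Suc n). R y v} +
      (case n of 0 \<Rightarrow> 0 | Suc n' \<Rightarrow> card {v \<in> L n'. R y v}))"
    proof (rule sum_mono)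
      fix y assume y: "y \<in> L n"
      have "c * (b + 3) \<le> card {v \<in> V. R y v}" using deg[of y] y by (auto simp: c_def L_def)
      also have "\<dots> \<le> card ({v \<in> L (Suc n). R y v} \<union> (case n of 0 \<Rightarrow> {} | Suc n' \<Rightarrow> {v \<in> L n'. R y v}))"
        using nbrs[OF y] finL by (intro card_mono) (auto split: nat.splits)
      also have "\<dots> \<le> card {v \<in> L (Suc n). R y v} + card (case n of 0 \<Rightarrow> {} | Suc n' \<Rightarrow> {v \<in> L n'. R y v})"
        by (rule card_Un_le)
      also have "card (case n of 0 \<Rightarrow> {} | Suc n' \<Rightarrow> {v \<in> L n'. R y v}) =
        (case n of 0 \<Rightarrow> 0 | Suc n' \<Rightarrow> card {v \<in> L n'. R y v})" by (cases n) auto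
      finally show "c * (b + 3) \<le> card {v \<in> L (Suc n). R y v} +
        (case n of 0 \<Rightarrow> 0 | Suc n' \<Rightarrow> card {v \<in> L n'. R y v})" .
    qed
    also have "\<dots> = e n + (case n of 0 \<Rightarrow> 0 | Suc n' \<Rightarrow> e n')"
      by (cases n) (simp_all add: sum.distrib up e_def)
    finally show ?thesis .
  qed
  have c0: "c > 0" by (simp add: c_def)
  have grow: "n < k \<Longrightarrow> b * card (L n) \<le> card (L (Suc n))" for n
  proof (induction n)
    case 0
    have "c * ((b + 3) * card (L 0)) \<le> c * (card (L 0) + card (L (Suc 0)))"
      using degsum[of 0] e[OF 0] unfolding mult.assoc[symmetric] nat.case add_0_right
      by (rule order_trans)
    then have "(b + 3) * card (L 0) \<le> card (L 0) + card (L (Suc 0))"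
      using c0 by simp
    then show ?case by (simp add: algebra_simps)
  next
    case (Suc n)
    have "c * (b + 3) * card (L (Suc n)) \<le>
      c * (card (L (Suc n)) + card (L (Suc (Suc n)))) + c * (card (L n) + card (L (Suc n)))"
      using degsum[of "Suc n"] e[OF Suc.prems] e[of n] Suc.prems by simp
    then have "c * ((b + 3) * card (L (Suc n))) \<le>
      c * (card (L (Suc n)) + card (L (Suc (Suc n))) + (card (L n) + card (L (Suc n))))"
      by (simp add: algebra_simps)
    then have 1: "(b + 3) * card (L (Suc n)) \<le>
      card (L (Suc n)) + card (L (Suc (Suc n))) + (card (L n) + card (L (Suc n)))"
      using c0 by simp
    have "1 * card (L n) \<le> b * card (L n)" using b by (intro mult_right_mono) auto
    moreover have "b * card (L n) \<le> card (L (Suc n))" using Suc by simp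
    ultimately have "card (L n) \<le> card (L (Suc n))" by linarith
    then show ?case using 1 by (simp add: algebra_simps)
  qed
  have "n \<le> k \<Longrightarrow> b ^ n \<le> card (L n)" for n
  proof (induction n)
    case 0
    then show ?case using L0 by simp
  next
    case (Suc n)
    then have "b * b ^ n \<le> b * card (L n)" by simp
    also have "\<dots> \<le> card (L (Suc n))" using grow Suc by simp
    finally show ?case by simp
  qed
  then have "b ^ k \<le> card (L k)" by simp
  also have "\<dots> \<le> card V" using fin by (intro card_mono) (auto simp: L_def)
  finally show False using b by simp
qed

section \<open>The upper bound\<close>

lemma has_cycle_mono:
  assumes "has_cycle R m" "\<And>u v. R u v \<Longrightarrow> R' u v"
  shows "has_cycle R' m"
  using assms unfolding has_cycle_def by blast

text \<open>The bridge from records to relations: both bounds work with \<open>has_cycle\<close> on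
  a colour class. For the converse, \<open>K\<close> is the image of \<open>cycle_graph m\<close>
  without chords of the same colour, because \<open>isomorphic\<close> demands equivalence of
  adjacency.\<close>

lemma monochromatic_cycle_iff:
  assumes "simple_graph H" "3 \<le> m"
  shows "(\<exists>K :: 'a sgraph. subgraph K H \<and> monochromatic f K \<and> isomorphic K (cycle_graph m)) \<longleftrightarrow>
    (\<exists>c. has_cycle (\<lambda>u v. {u, v} \<in> edges H \<and> f {u, v} = c) m)" (is "?L \<longleftrightarrow> ?R")
proof
  assume ?L
  then obtain K :: "'a sgraph" where K: "subgraph K H" "monochromatic f K" "isomorphic K (cycle_graph m)"
    by blast
  obtain c where c: "\<forall>e\<in>edges K. f e = c" using K(2) by (auto simp: monochromatic_def)
  have "vertices (cycle_graph m) = {..<m}" by (simp add: cycle_graph_def)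
  then obtain \<phi> where bij: "bij_betw \<phi> (vertices K) {..<m}"
    and iso: "\<And>u v. u \<in> vertices K \<Longrightarrow> v \<in> vertices K \<Longrightarrow>
      {u, v} \<in> edges K \<longleftrightarrow> {\<phi> u, \<phi> v} \<in> edges (cycle_graph m)"
    using K(3) unfolding isomorphic_def by metis
  define v where "v = inv_into (vertices K) \<phi>"
  have v: "v i \<in> vertices K" "\<phi> (v i) = i" if "i < m" for i
    using bij that by (auto simp: v_def bij_betw_def inv_into_into f_inv_into_f)
  have "has_cycle (\<lambda>u v. {u, v} \<in> edges H \<and> f {u, v} = c) m"
    unfolding has_cycle_def
  proof (intro exI[of _ v] conjI allI impI)
    show "inj_on v {..<m}" using v(2) by (metis inj_on_inverseI lessThan_iff)
  next
    fix i assume i: "i < m"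
    have s: "Suc i mod m < m" using i by simp
    have "{i, Suc i mod m} \<in> edges (cycle_graph m)" using i by (auto simp: cycle_graph_def)
    then have e: "{v i, v (Suc i mod m)} \<in> edges K" using iso v i s by simp
    then show "f {v i, v (Suc i mod m)} = c" using c by blast
    show "{v i, v (Suc i mod m)} \<in> edges H" using e K by (auto simp: subgraph_def)
  qed
  then show ?R by blast
next
  assume ?R
  then obtain c v where v: "inj_on v {..<m}"
    "\<And>i. i < m \<Longrightarrow> {v i, v (Suc i mod m)} \<in> edges H \<and> f {v i, v (Suc i mod m)} = c"
    unfolding has_cycle_def by blast
  define K where "K = \<lparr>vertices = v ` {..<m}, edges = (`) v ` edges (cycle_graph m)\<rparr>"
  have e: "\<exists>i<m. e = {v i, v (Suc i mod m)}" if "e \<in> edges K" for e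
    using that by (auto simp: K_def cycle_graph_def)
  have sub: "e \<subseteq> {..<m}" if "e \<in> edges (cycle_graph m)" for e
    using that assms(2) by (auto simp: cycle_graph_def)
  have "subgraph K H"
    unfolding subgraph_def simple_graph_def
  proof (intro conjI ballI)
    show "finite (vertices K)" by (simp add: K_def)
    show "e \<subseteq> vertices K" if "e \<in> edges K" for e
      using that sub by (auto simp: K_def)
    show "card e = 2" if "e \<in> edges K" for e
      using e[OF that] v(2) assms(1) by (auto simp: simple_graph_def)
    show "vertices K \<subseteq> vertices H"
    proof
      fix x assume "x \<in> vertices K"
      then obtain i where i: "i < m" "x = v i" by (auto simp: K_def)
      have "{v i, v (Suc i mod m)} \<subseteq> vertices H"
        using v(2)[OF i(1)] assms(1) unfolding simple_graph_def by blast
      then show "x \<in> vertices H" using i by simp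
    qed
    show "edges K \<subseteq> edges H" using e v(2) by auto
  qed
  moreover have "monochromatic f K"
    unfolding monochromatic_def using e v(2) by blast
  moreover have "isomorphic K (cycle_graph m)"
    unfolding isomorphic_def
  proof (intro exI[of _ "inv_into {..<m} v"] conjI ballI)
    show "bij_betw (inv_into {..<m} v) (vertices K) (vertices (cycle_graph m))"
      using v(1) by (simp add: K_def cycle_graph_def bij_betw_inv_into inj_on_imp_bij_betw)
  next
    fix a b assume "a \<in> vertices K" "b \<in> vertices K"
    then obtain i j where ij: "i < m" "j < m" "a = v i" "b = v j" by (auto simp: K_def)
    have "{a, b} \<in> edges K \<longleftrightarrow> (\<exists>e\<in>edges (cycle_graph m). v ` {i, j} = v ` e)"
      using ij by (auto simp: K_def)
    also have "\<dots> \<longleftrightarrow> (\<exists>e\<in>edges (cycle_graph m). {i, j} = e)"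
      using ij sub inj_on_image_eq_iff[OF v(1), of "{i, j}"] by (intro bex_cong) auto
    also have "\<dots> \<longleftrightarrow> {inv_into {..<m} v a, inv_into {..<m} v b} \<in> edges (cycle_graph m)"
      using ij v(1) by simp
    finally show "{a, b} \<in> edges K \<longleftrightarrow>
      {inv_into {..<m} v a, inv_into {..<m} v b} \<in> edges (cycle_graph m)" .
  qed
  ultimately show ?L by blast
qed

lemma arrows_cycle_iff:
  assumes "simple_graph H" "3 \<le> m"
  shows "arrows H s (cycle_graph m) \<longleftrightarrow>
    (\<forall>f. f ` edges H \<subseteq> {..<s} \<longrightarrow> (\<exists>c. has_cycle (\<lambda>u v. {u, v} \<in> edges H \<and> f {u, v} = c) m))"
  unfolding arrows_def monochromatic_cycle_iff[OF assms] ..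

definition complete_bipartite :: "nat \<Rightarrow> nat sgraph" where
  "complete_bipartite N =
    \<lparr>vertices = {..<2 * N}, edges = (\<lambda>(u, v). {u, v}) ` ({..<N} \<times> {N..<2 * N})\<rparr>"

lemma simple_graph_complete_bipartite: "simple_graph (complete_bipartite N)"
  by (auto simp: simple_graph_def complete_bipartite_def)

lemma max_degree_complete_bipartite: "max_degree (complete_bipartite N) \<le> N"
proof -
  have "Defs.degree (complete_bipartite N) v \<le> N" for v
  proof (cases "v < N")
    case True
    have "{e \<in> edges (complete_bipartite N). v \<in> e} \<subseteq> (\<lambda>w. {v, w}) ` {N..<2 * N}"
      using True by (auto simp: complete_bipartite_def)
    then have "Defs.degree (complete_bipartite N) v \<le> card {N..<2 * N}"
      unfolding Defs.degree_def by (rule surj_card_le[rotated]) simp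
    then show ?thesis by simp
  next
    case False
    have "{e \<in> edges (complete_bipartite N). v \<in> e} \<subseteq> (\<lambda>w. {w, v}) ` {..<N}"
      using False by (auto simp: complete_bipartite_def)
    then have "Defs.degree (complete_bipartite N) v \<le> card {..<N}"
      unfolding Defs.degree_def by (rule surj_card_le[rotated]) simp
    then show ?thesis by simp
  qed
  then show ?thesis unfolding max_degree_def
    by (subst Max_le_iff) (auto simp: complete_bipartite_def)
qed

text \<open>With d for \<open>(4 * k * k + 1) * (b + 3)\<close>, some colour has at least
  \<open>2 * d * N\<close> edges, because \<open>N * N\<close> edges share \<open>s\<close> colours.
  Its average degree on \<open>2 * N\<close> vertices is at least \<open>2 * d\<close>, and a
  subgraph of minimum degree \<open>d\<close> still has fewer than \<open>b ^ k\<close>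
  vertices.\<close>

lemma complete_bipartite_arrows_even_cycle:
  assumes k: "2 \<le> k" and s: "1 \<le> s" and b: "1 \<le> b"
    and N: "2 * s * ((4 * k * k + 1) * (b + 3)) \<le> N" "2 * N < b ^ k"
  shows "arrows (complete_bipartite N) s (cycle_graph (2 * k))"
proof -
  have m3: "3 \<le> 2 * k" using k by simp
  let ?H = "complete_bipartite N"
  show ?thesis
    unfolding arrows_cycle_iff[OF simple_graph_complete_bipartite m3]
  proof (intro allI impI)
    fix f assume f: "f ` edges ?H \<subseteq> {..<s}"
    define d where "d = (4 * k * k + 1) * (b + 3)"
    have Npos: "N > 0" using N(1) s b by (cases N) auto
    define p where "p c = {(u, v) \<in> {..<N} \<times> {N..<2 * N}. f {u, v} = c}" for c
    have finp: "finite (p c)" for c unfolding p_def by (rule finite_subset[of _ "{..<N} \<times> {N..<2 * N}"]) auto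
    have "(\<Sum>c<s. card (p c)) = card ({..<N} \<times> {N..<2 * N})"
    proof -
      have "{..<N} \<times> {N..<2 * N} = (\<Union>c\<in>{..<s}. p c)"
        using f by (force simp: p_def complete_bipartite_def)
      also have "card \<dots> = (\<Sum>c<s. card (p c))"
        by (rule card_UN_disjoint) (use finp in \<open>auto simp: p_def\<close>)
      finally show ?thesis by simp
    qed
    then have tot: "(\<Sum>c<s. card (p c)) = N * N" by simp
    have "\<exists>c<s. 2 * d * N \<le> card (p c)"
    proof (rule ccontr)
      assume "\<not> ?thesis"
      then have "\<And>c. c < s \<Longrightarrow> card (p c) < 2 * d * N" by (auto simp: not_le)
      then have "(\<Sum>c<s. card (p c)) < (\<Sum>c<s. 2 * d * N)"
        using s by (intro sum_strict_mono) (auto simp: lessThan_empty_iff)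
      also have "\<dots> = (2 * s * d) * N" by simp
      also have "\<dots> \<le> N * N" using N(1) unfolding d_def by (rule mult_right_mono) simp
      finally show False using tot by simp
    qed
    then obtain c where c: "c < s" "2 * d * N \<le> card (p c)" by auto
    define R where "R u v \<longleftrightarrow> {u, v} \<in> edges ?H \<and> f {u, v} = c" for u v
    have Rsym: "R u v \<Longrightarrow> R v u" for u v by (simp add: R_def insert_commute)
    have RV: "u \<in> {..<2 * N} \<and> v \<in> {..<2 * N} \<and> (u < N) \<noteq> (v < N)" if "R u v" for u v
      using that by (auto simp: R_def complete_bipartite_def doubleton_eq_iff)
    have pR: "(u, v) \<in> p c \<longleftrightarrow> u < N \<and> R u v" for u v
      by (auto simp: p_def R_def complete_bipartite_def doubleton_eq_iff)
    have 1: "(\<Sum>u<N. card {v \<in> {..<2 * N}. R u v}) = card (p c)"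
    proof -
      have "p c = (SIGMA u:{..<N}. {v \<in> {..<2 * N}. R u v})"
        using pR RV by auto
      then show ?thesis by simp
    qed
    have 2: "(\<Sum>u\<in>{N..<2 * N}. card {v \<in> {..<2 * N}. R u v}) = card (p c)"
    proof -
      have "prod.swap ` p c = (SIGMA u:{N..<2 * N}. {v \<in> {..<2 * N}. R u v})"
      proof (intro Set.set_eqI iffI)
        fix z assume "z \<in> prod.swap ` p c"
        then show "z \<in> (SIGMA u:{N..<2 * N}. {v \<in> {..<2 * N}. R u v})"
          using pR RV Rsym by fastforce
      next
        fix z assume "z \<in> (SIGMA u:{N..<2 * N}. {v \<in> {..<2 * N}. R u v})"
        then have "(snd z, fst z) \<in> p c" using pR RV Rsym by fastforce
        then show "z \<in> prod.swap ` p c" by force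
      qed
      then have "card (prod.swap ` p c) = (\<Sum>u\<in>{N..<2 * N}. card {v \<in> {..<2 * N}. R u v})" by simp
      then show ?thesis by (simp add: card_image)
    qed
    have "(\<Sum>u<2 * N. card {v \<in> {..<2 * N}. R u v}) = 2 * card (p c)"
    proof -
      have "{..<2 * N} = {..<N} \<union> {N..<2 * N}" by auto
      then have "(\<Sum>u<2 * N. card {v \<in> {..<2 * N}. R u v}) =
        (\<Sum>u\<in>{..<N} \<union> {N..<2 * N}. card {v \<in> {..<2 * N}. R u v})" by simp
      also have "\<dots> = 2 * card (p c)" using 1 2 by (subst sum.union_disjoint) auto
      finally show ?thesis .
    qed
    then have "2 * d * card {..<2 * N} \<le> (\<Sum>u<2 * N. card {v \<in> {..<2 * N}. R u v})"
      using c(2) by (simp add: mult_ac)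
    moreover have "finite {..<2 * N}" "{..<2 * N} \<noteq> {}" using Npos by (auto simp: lessThan_empty_iff)
    ultimately have "\<exists>S\<subseteq>{..<2 * N}. S \<noteq> {} \<and> (\<forall>u\<in>S. d \<le> card {v \<in> S. R u v})"
      using Rsym by (intro min_degree_subgraph)
    then obtain S where S: "S \<subseteq> {..<2 * N}" "S \<noteq> {}" "\<And>u. u \<in> S \<Longrightarrow> d \<le> card {v \<in> S. R u v}"
      by blast
    obtain x where x: "x \<in> S" using S by auto
    have cS: "card S \<le> 2 * N" using card_mono[OF _ S(1)] by simp
    have "has_cycle (\<lambda>u v. R u v \<and> u \<in> S \<and> v \<in> S) (2 * k)"
    proof (rule even_cycle_of_min_degree[where V = S and x = x and side = "\<lambda>u. u < N" and b = b])
      show "finite S" using S finite_subset by blast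
      show "(4 * k * k + 1) * (b + 3) \<le> card {v \<in> S. R u v \<and> u \<in> S \<and> v \<in> S}" if "u \<in> S" for u
      proof -
        have "{v \<in> S. R u v \<and> u \<in> S \<and> v \<in> S} = {v \<in> S. R u v}" using that by auto
        then show ?thesis using S(3)[OF that] by (simp add: d_def)
      qed
      show "card S < b ^ k" using cS N(2) by simp
    qed (use x Rsym RV k b in auto)
    then show "\<exists>c. has_cycle (\<lambda>u v. {u, v} \<in> edges ?H \<and> f {u, v} = c) (2 * k)"
      by (intro exI[of _ c]) (erule has_cycle_mono, simp add: R_def)
  qed
qed

text \<open>Here \<open>N\<close> is of order \<open>s * b\<close>, and \<open>2 * N < b ^ k\<close>
  then requires \<open>b\<close> of order \<open>s powr (1 / (k - 1))\<close>. The degree is at most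
  \<open>N\<close>, of order \<open>s powr (1 + 1 / (k - 1))\<close>.\<close>

lemma degree_ramsey_even_cycle_upper:
  assumes k: "2 \<le> k"
  shows "\<exists>C>0. \<forall>s\<ge>1. \<exists>H :: nat sgraph. simple_graph H \<and> arrows H s (cycle_graph (2 * k)) \<and>
    real (max_degree H) \<le> C * real s powr (real k / (real k - 1))"
proof -
  define c where "c = 4 * k * k + 1"
  define a where "a = 1 / (real k - 1)"
  have a: "a > 0" "a * (real k - 1) = 1" using k by (auto simp: a_def)
  define C where "C = 16 * real c * (8 * real c) powr a"
  have c: "c \<ge> 1" by (simp add: c_def)
  have "C > 0" using c by (simp add: C_def)
  moreover have "\<exists>H :: nat sgraph. simple_graph H \<and> arrows H s (cycle_graph (2 * k)) \<and>
    real (max_degree H) \<le> C * real s powr (real k / (real k - 1))" if s: "1 \<le> s" for s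
  proof -
    define z where "z = (8 * real s * real c) powr a"
    have sc: "1 \<le> real s * real c" using s c by (metis mult_le_mono nat_mult_1 of_nat_1 of_nat_le_iff of_nat_mult)
    have z1: "z \<ge> 1" unfolding z_def using sc a by (intro ge_one_powr_ge_zero) auto
    \<comment> \<open>The offset makes \<open>b\<close> exceed \<open>z\<close> and gives
      \<open>b + 3 \<le> 2 * b\<close>; since \<open>z \<ge> 1\<close>, still
      \<open>b \<le> 4 * z\<close>.\<close>
    define b where "b = nat \<lfloor>z\<rfloor> + 3"
    have b: "z < real b" "real b \<le> 4 * z" "b \<ge> 3"
      using z1 by (auto simp: b_def) linarith+
    define N where "N = 2 * s * (c * (b + 3))"
    have "8 * real s * real c = z powr (real k - 1)"
      using a sc by (simp add: z_def powr_powr)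
    also have "\<dots> < real b powr (real k - 1)"
      using z1 b k by (intro powr_less_mono2) auto
    also have "\<dots> = real b ^ (k - 1)"
      using b k by (simp add: powr_realpow[symmetric] of_nat_diff)
    finally have "real (8 * s * c) < real (b ^ (k - 1))" by simp
    then have 1: "8 * s * c < b ^ (k - 1)" unfolding of_nat_less_iff .
    have "2 * N = 4 * s * c * (b + 3)" by (simp add: N_def)
    also have "\<dots> \<le> 4 * s * c * (2 * b)" using b by (intro mult_left_mono) auto
    also have "\<dots> = (8 * s * c) * b" by simp
    also have "\<dots> < b ^ (k - 1) * b" using 1 b by simp
    also have "\<dots> = b ^ k" using k by (cases k) auto
    finally have N2: "2 * N < b ^ k" .
    have "arrows (complete_bipartite N) s (cycle_graph (2 * k))"
      by (rule complete_bipartite_arrows_even_cycle[OF k s _ _ N2]) (use b in \<open>auto simp: N_def c_def\<close>)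
    moreover have "real (max_degree (complete_bipartite N)) \<le> C * real s powr (real k / (real k - 1))"
    proof -
      have "N \<le> 4 * s * c * b"
      proof -
        have "N = 2 * s * c * (b + 3)" by (simp add: N_def)
        also have "\<dots> \<le> 2 * s * c * (2 * b)" using b by (intro mult_left_mono) auto
        finally show ?thesis by simp
      qed
      then have "max_degree (complete_bipartite N) \<le> 4 * s * c * b"
        using max_degree_complete_bipartite[of N] by linarith
      then have "real (max_degree (complete_bipartite N)) \<le> real (4 * s * c * b)"
        unfolding of_nat_le_iff .
      also have "\<dots> = 4 * real s * real c * real b" by simp
      also have "\<dots> \<le> 4 * real s * real c * (4 * z)"
        using b by (intro mult_left_mono) auto
      also have "z = (8 * real c) powr a * real s powr a"
        by (simp add: z_def powr_mult mult_ac)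
      also have "4 * real s * real c * (4 * ((8 * real c) powr a * real s powr a)) = C * (real s powr 1 * real s powr a)"
        using s by (simp add: C_def)
      also have "real s powr 1 * real s powr a = real s powr (1 + a)" by (simp add: powr_add)
      also have "1 + a = real k / (real k - 1)" using k by (simp add: a_def field_simps)
      finally show ?thesis .
    qed
    ultimately show ?thesis using simple_graph_complete_bipartite by blast
  qed
  ultimately show ?thesis by blast
qed

section \<open>Wenger's decomposition of the complete bipartite graph\<close>

text \<open>Split off a linear factor: as the derivative does not vanish at \<open>a\<close>, the
  root \<open>a\<close> is simple and is not counted again among the roots of the quotient.\<close>

lemma card_poly_roots_separable:
  fixes p :: "'a :: alg_closed_field poly"
  assumes "p \<noteq> 0" "\<And>x. poly p x = 0 \<Longrightarrow> poly (pderiv p) x \<noteq> 0"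
  shows "card {x. poly p x = 0} = Polynomial.degree p"
  using assms
proof (induction "Polynomial.degree p" arbitrary: p)
  case 0
  then obtain c where "p = [:c:]" by (auto elim: degree_eq_zeroE)
  then show ?case using 0 by auto
next
  case (Suc n)
  obtain a where a: "poly p a = 0"
    using alg_closed_imp_poly_has_root[of p] Suc by auto
  then obtain q where q: "p = [:- a, 1:] * q" by (auto simp: poly_eq_0_iff_dvd elim: dvdE)
  have q0: "q \<noteq> 0" using q Suc by auto
  have d: "Polynomial.degree p = Suc (Polynomial.degree q)"
    unfolding q using q0 by (subst degree_mult_eq) auto
  have pd: "poly (pderiv p) x = (x - a) * poly (pderiv q) x + poly q x" for x
    unfolding q pderiv_mult by (simp add: pderiv_pCons algebra_simps)
  have qa: "poly q a \<noteq> 0" using Suc.prems(2)[OF a] by (simp add: pd)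
  have "card {x. poly q x = 0} = Polynomial.degree q"
  proof (rule Suc.hyps(1))
    show "poly (pderiv q) x \<noteq> 0" if "poly q x = 0" for x
    proof -
      have "poly p x = 0" using that by (simp add: q)
      then show ?thesis using Suc.prems(2)[of x] that by (auto simp: pd)
    qed
  qed (use d Suc q0 in auto)
  moreover have "{x. poly p x = 0} = insert a {x. poly q x = 0}" by (auto simp: q)
  moreover have "finite {x. poly q x = 0}" using q0 by (rule poly_roots_finite)
  ultimately show ?case using d qa by simp
qed

text \<open>The finite field of order \<open>2 ^ r\<close>, as the fixed points of a power of the
  Frobenius map: \<open>x ^ q - x\<close> has derivative -1 in characteristic 2, hence
  \<open>q\<close> simple roots. Powers of two suffice because consecutive ones differ by a constant
  factor.\<close>

lemma subfield_of_two_power_order: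
  "\<exists>K :: bit alg_closure set. finite K \<and> card K = 2 ^ r \<and> 0 \<in> K \<and>
     (\<forall>x\<in>K. \<forall>y\<in>K. x + y \<in> K \<and> x - y \<in> K \<and> x * y \<in> K)"
proof (cases "r = 0")
  \<comment> \<open>A field with one element does not exist, but \<open>{0}\<close> has the closure
    properties.\<close>
  case True
  then show ?thesis by (intro exI[of _ "{0}"]) auto
next
  case False
  define q :: nat where "q = 2 ^ r"
  have q: "q > 1" "even q" using False one_less_power[of "2::nat" r] by (auto simp: q_def)
  have two: "(2 :: bit alg_closure) = 0"
  proof -
    have "to_ac (2 :: bit) = to_ac 0" by simp
    then show ?thesis by (simp only: to_ac_numeral to_ac_0)
  qed
  have neg: "- x = x" for x :: "bit alg_closure"
    by (metis add.right_neutral add_eq_0_iff mult_2 mult_zero_left two)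
  have frob: "(x + y) ^ (2 ^ n) = x ^ (2 ^ n) + y ^ (2 ^ n)" for x y :: "bit alg_closure" and n
    by (induction n) (simp_all add: power_mult power2_sum two mult.commute[of 2])
  define K where "K = {x :: bit alg_closure. x ^ q = x}"
  define p :: "bit alg_closure poly" where "p = Polynomial.monom 1 q - [:0, 1:]"
  have K: "K = {x. poly p x = 0}" by (auto simp: K_def p_def poly_monom)
  have dp: "Polynomial.degree p = q"
  proof -
    have "Polynomial.degree (- [:0, 1 :: bit alg_closure:]) < Polynomial.degree (Polynomial.monom (1 :: bit alg_closure) q)"
      using q by (simp add: degree_monom_eq)
    then show ?thesis
      unfolding p_def diff_conv_add_uminus
      by (subst degree_add_eq_left) (auto simp: degree_monom_eq)
  qed
  have "of_nat q = (0 :: bit alg_closure)"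
    using q by (auto elim!: evenE simp: two)
  then have "pderiv p = [:- 1:]"
    by (simp add: p_def pderiv_diff pderiv_monom pderiv_pCons)
  then have "card K = q"
    unfolding K dp[symmetric] by (intro card_poly_roots_separable) (use dp q in auto)
  moreover have "finite K" using calculation q by (auto intro: card_ge_0_finite)
  moreover have "0 \<in> K" using q by (auto simp: K_def)
  moreover have "x + y \<in> K" "x - y \<in> K" "x * y \<in> K" if "x \<in> K" "y \<in> K" for x y
  proof -
    show 1: "x + y \<in> K" using that by (simp add: K_def q_def frob)
    then show "x - y \<in> K" using neg[of y] by (metis diff_conv_add_uminus)
    show "x * y \<in> K" using that by (simp add: K_def power_mult_distrib)
  qed
  ultimately show ?thesis unfolding q_def by blast
qed

text \<open>
  Along the walk \<open>P (i + 1) r - P i r = d i * x i ^ r\<close>, so \<open>\<Sum>i. d i * g (x i) = 0\<close> for every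
  polynomial \<open>g\<close> of degree below \<open>k\<close>. Cyclically adjacent \<open>x i\<close> differ, which for \<open>k = 3, 5\<close> leaves
  some \<open>x i0\<close> that occurs only once; take \<open>g\<close> vanishing at all the others.
\<close>

lemma wenger_no_closed_walk:
  fixes P L :: "nat \<Rightarrow> nat \<Rightarrow> 'a :: field"
  assumes k: "k = 3 \<or> k = 5"
    and eq1: "\<And>i r. i < k \<Longrightarrow> 1 \<le> r \<Longrightarrow> r < k \<Longrightarrow> P i r + L i r - P i 0 * L i 0 ^ r = C r"
    and eq2: "\<And>i r. i < k \<Longrightarrow> 1 \<le> r \<Longrightarrow> r < k \<Longrightarrow>
      P (Suc i mod k) r + L i r - P (Suc i mod k) 0 * L i 0 ^ r = C r"
    and neP: "\<And>i. i < k \<Longrightarrow> \<exists>r<k. P i r \<noteq> P (Suc i mod k) r"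
    and neL: "\<And>i. i < k \<Longrightarrow> \<exists>r<k. L i r \<noteq> L (Suc i mod k) r"
  shows False
proof -
  define d where "d i = P (Suc i mod k) 0 - P i 0" for i
  define x where "x i = L i 0" for i
  have diff: "P (Suc i mod k) r - P i r = d i * x i ^ r" if "i < k" "r < k" for i r
  proof (cases "r = 0")
    case False
    have "P i r = C r - L i r + P i 0 * L i 0 ^ r"
      using eq1[of i r] that False by (simp add: algebra_simps)
    moreover have "P (Suc i mod k) r = C r - L i r + P (Suc i mod k) 0 * L i 0 ^ r"
      using eq2[of i r] that False by (simp add: algebra_simps)
    ultimately show ?thesis by (simp add: d_def x_def left_diff_distrib)
  qed (simp add: d_def)
  have d0: "d i \<noteq> 0" if "i < k" for i
    using neP[OF that] diff[OF that] by auto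
  \<comment> \<open>A line is determined by its coordinate 0 and one of its points. Consecutive
    lines share \<open>P (Suc i mod k)\<close>, so with equal coordinates 0 they would
    coincide.\<close>
  have xne: "x i \<noteq> x (Suc i mod k)" if i: "i < k" for i
  proof
    assume eq: "x i = x (Suc i mod k)"
    obtain r where r: "r < k" "L i r \<noteq> L (Suc i mod k) r" using neL[OF i] by auto
    then have "r \<noteq> 0" using eq by (metis x_def)
    then have "L i r = C r - P (Suc i mod k) r + P (Suc i mod k) 0 * x i ^ r"
      using eq2[OF i, of r] r by (simp add: x_def algebra_simps)
    moreover have "L (Suc i mod k) r = C r - P (Suc i mod k) r + P (Suc i mod k) 0 * x i ^ r"
      using eq1[of "Suc i mod k" r] r i \<open>r \<noteq> 0\<close> unfolding eq by (simp add: x_def algebra_simps)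
    ultimately show False using r by simp
  qed
  have "\<exists>i0<k. \<forall>i<k. i \<noteq> i0 \<longrightarrow> x i \<noteq> x i0"
    using k
  proof
    assume k: "k = 3"
    have "x 0 \<noteq> x 1" "x 1 \<noteq> x 2" "x 2 \<noteq> x 0"
      using xne[of 0] xne[of 1] xne[of 2] by (simp_all add: k numeral_2_eq_2)
    moreover have "(\<forall>i<3. Q i) \<longleftrightarrow> Q 0 \<and> Q 1 \<and> Q 2" for Q :: "nat \<Rightarrow> bool"
      by (auto simp: numeral_eq_Suc less_Suc_eq)
    ultimately show ?thesis
      unfolding k by (intro exI[of _ 0]) (simp add: numeral_2_eq_2)
  next
    assume k: "k = 5"
    have ne: "x 0 \<noteq> x 1" "x 1 \<noteq> x 2" "x 2 \<noteq> x 3" "x 3 \<noteq> x 4" "x 4 \<noteq> x 0"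
    proof -
      have m: "Suc 0 mod 5 = 1" "Suc 1 mod 5 = 2" "Suc 2 mod 5 = 3" "Suc 3 mod 5 = 4" "Suc 4 mod 5 = 0"
        by simp_all
      show "x 0 \<noteq> x 1" using xne[of 0] unfolding k m by simp
      show "x 1 \<noteq> x 2" using xne[of 1] unfolding k m by simp
      show "x 2 \<noteq> x 3" using xne[of 2] unfolding k m by simp
      show "x 3 \<noteq> x 4" using xne[of 3] unfolding k m by simp
      show "x 4 \<noteq> x 0" using xne[of 4] unfolding k m by simp
    qed
    have five: "(\<forall>i<5. Q i) \<longleftrightarrow> Q 0 \<and> Q 1 \<and> Q 2 \<and> Q 3 \<and> Q 4" for Q :: "nat \<Rightarrow> bool"
      by (auto simp: numeral_eq_Suc less_Suc_eq)
    \<comment> \<open>Without adjacent repetitions a value occurs at most twice in five cyclic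
      places, and five is odd. The cases locate a value that occurs once.\<close>
    consider "x 0 \<noteq> x 2" "x 0 \<noteq> x 3" | "x 0 = x 2" "x 1 \<noteq> x 3" | "x 0 = x 2" "x 1 = x 3"
      | "x 0 = x 3" "x 1 \<noteq> x 4" | "x 0 = x 3" "x 1 = x 4" by blast
    then have "\<exists>i0<5. \<forall>i<5. i \<noteq> i0 \<longrightarrow> x i \<noteq> x i0"
    proof cases
      case 1 then show ?thesis unfolding five by (intro exI[of _ 0]) (use ne in simp)
    next
      case 2 then show ?thesis unfolding five by (intro exI[of _ 3]) (use ne in simp)
    next
      case 3 then show ?thesis unfolding five by (intro exI[of _ 4]) (use ne in simp)
    next
      case 4 then show ?thesis unfolding five by (intro exI[of _ 1]) (use ne in simp)
    next
      case 5 then show ?thesis unfolding five by (intro exI[of _ 2]) (use ne in simp)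
    qed
    then show ?thesis unfolding k .
  qed
  then obtain i0 where i0: "i0 < k" "\<And>i. i < k \<Longrightarrow> i \<noteq> i0 \<Longrightarrow> x i \<noteq> x i0" by auto
  have bij: "bij_betw (\<lambda>i. Suc i mod k) {..<k} {..<k}"
  proof -
    have inj: "inj_on (\<lambda>i. Suc i mod k) {..<k}"
      by (auto simp: inj_on_def mod_Suc split: if_splits)
    moreover have "(\<lambda>i. Suc i mod k) ` {..<k} \<subseteq> {..<k}" using k by auto
    ultimately show ?thesis by (simp add: bij_betw_def endo_inj_surj)
  qed
  have zero: "(\<Sum>i<k. d i * x i ^ r) = 0" if "r < k" for r
  proof -
    have "(\<Sum>i<k. d i * x i ^ r) = (\<Sum>i<k. P (Suc i mod k) r) - (\<Sum>i<k. P i r)"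
      using diff that by (simp add: sum_subtractf[symmetric])
    also have "(\<Sum>i<k. P (Suc i mod k) r) = (\<Sum>i<k. P i r)"
      by (rule sum.reindex_bij_betw[OF bij])
    finally show ?thesis by simp
  qed
  define g where "g = (\<Prod>i\<in>{..<k} - {i0}. [:- x i, 1:])"
  have deg: "Polynomial.degree g < k"
  proof -
    have "Polynomial.degree g \<le> sum (Polynomial.degree \<circ> (\<lambda>i. [:- x i, 1:])) ({..<k} - {i0})"
      unfolding g_def by (rule degree_prod_sum_le) simp
    also have "\<dots> = k - 1" using i0 by simp
    finally show ?thesis using k by auto
  qed
  have "(\<Sum>i<k. d i * poly g (x i)) = (\<Sum>i<k. \<Sum>r\<le>Polynomial.degree g. coeff g r * (d i * x i ^ r))"
    by (simp add: poly_altdef sum_distrib_left algebra_simps)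
  also have "\<dots> = (\<Sum>r\<le>Polynomial.degree g. coeff g r * (\<Sum>i<k. d i * x i ^ r))"
    by (subst sum.swap) (simp add: sum_distrib_left)
  also have "\<dots> = 0" using zero deg by (intro sum.neutral) auto
  also have "(\<Sum>i<k. d i * poly g (x i)) = (\<Sum>i<k. if i = i0 then d i0 * poly g (x i0) else 0)"
  proof (rule sum.cong)
    fix i assume "i \<in> {..<k}"
    then show "d i * poly g (x i) = (if i = i0 then d i0 * poly g (x i0) else 0)"
      by (auto simp: g_def poly_prod intro!: prod_zero bexI[of _ i])
  qed simp
  also have "\<dots> = d i0 * poly g (x i0)" using i0 by simp
  finally have "poly g (x i0) = 0" using d0[OF i0(1)] by simp
  then show False using i0 by (auto simp: g_def poly_prod) metis
qed

lemma exists_inj_on_lessThan: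
  assumes "finite B" "m \<le> card B"
  shows "\<exists>h. inj_on h {..<m} \<and> h ` {..<m::nat} \<subseteq> B"
  using card_le_inj[of "{..<m}" B] assms by auto

lemma exists_index:
  assumes "finite B"
  shows "\<exists>h. inj_on h B \<and> h ` B \<subseteq> {..<card B}"
  using card_le_inj[of B "{..<card B}"] assms by auto

text \<open>Vertices on both sides become vectors with \<open>k\<close> coordinates over a field of
  order q. The colour of a pair is the vector of defects in Wenger's \<open>k - 1\<close> incidence
  equations, so every colour class is a Wenger graph with shifted constants and there are q^(k-1)
  colours. The last clause says that no colour has a non-backtracking closed walk of length
  \<open>2 * k\<close>.\<close>

lemma wenger_colouring:
  assumes k: "k = 3 \<or> k = 5" and m: "1 \<le> m"
  shows "\<exists>\<chi> s. (\<forall>i<m. \<forall>j<m. \<chi> i j < s) \<and> real s \<le> 2 ^ k * real m powr (1 - 1 / real k) \<and>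
    (\<forall>p l c. \<exists>i<k. \<not> (p i < m \<and> l i < m \<and> p i \<noteq> p (Suc i mod k) \<and> l i \<noteq> l (Suc i mod k) \<and>
       \<chi> (p i) (l i) = c \<and> \<chi> (p (Suc i mod k)) (l i) = (c :: nat)))"
proof -
  \<comment> \<open>The least order with enough vectors overshoots \<open>m\<close> by a factor of
    at most \<open>2 ^ k\<close>.\<close>
  define r where "r = (LEAST r. m \<le> (2 ^ r) ^ k)"
  have ex: "m \<le> (2 ^ m) ^ k"
  proof -
    have "m \<le> 2 ^ m" by simp
    also have "\<dots> \<le> (2 ^ m) ^ k" using k by (intro self_le_power) auto
    finally show ?thesis .
  qed
  have r1: "m \<le> (2 ^ r) ^ k" unfolding r_def using ex by (rule LeastI)
  have r2: "(2 ^ r) ^ k \<le> 2 ^ k * m"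
  proof (cases r)
    case 0
    then show ?thesis using m by (simp add: Suc_leI)
  next
    case (Suc r')
    then have "\<not> m \<le> (2 ^ r') ^ k" using not_less_Least[of r' "\<lambda>r. m \<le> (2 ^ r) ^ k"] by (simp add: r_def)
    then show ?thesis using Suc by (simp add: power_mult_distrib)
  qed
  obtain K :: "bit alg_closure set" where K: "finite K" "card K = 2 ^ r" "0 \<in> K"
    "\<And>x y. x \<in> K \<Longrightarrow> y \<in> K \<Longrightarrow> x + y \<in> K" "\<And>x y. x \<in> K \<Longrightarrow> y \<in> K \<Longrightarrow> x - y \<in> K"
    "\<And>x y. x \<in> K \<Longrightarrow> y \<in> K \<Longrightarrow> x * y \<in> K"
    using subfield_of_two_power_order[of r] by blast
  have Kpow: "x ^ Suc n \<in> K" if "x \<in> K" for x n by (induction n) (use that K in auto)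
  have Kpow': "x ^ n \<in> K" if "x \<in> K" "1 \<le> n" for x n
    using Kpow[OF that(1), of "n - 1"] that(2) by simp
  define A where "A = {..<k} \<rightarrow>\<^sub>E K"
  define B where "B = {1..<k} \<rightarrow>\<^sub>E K"
  have A: "finite A" "card A = (2 ^ r) ^ k" using K by (auto simp: A_def finite_PiE card_PiE)
  have B: "finite B" "card B = (2 ^ r) ^ (k - 1)" using K by (auto simp: B_def finite_PiE card_PiE)
  obtain \<phi> where \<phi>: "inj_on \<phi> {..<m}" "\<phi> ` {..<m} \<subseteq> A"
    using exists_inj_on_lessThan[of A m] A r1 by auto
  obtain \<gamma> where \<gamma>: "inj_on \<gamma> B" "\<gamma> ` B \<subseteq> {..<card B}" using exists_index[OF B(1)] by blast
  define V where "V i j = (\<lambda>n\<in>{1..<k}. \<phi> i n + \<phi> j n - \<phi> i 0 * \<phi> j 0 ^ n)" for i j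
  have VB: "V i j \<in> B" if "i < m" "j < m" for i j
  proof -
    have "\<phi> i n \<in> K" "\<phi> j n \<in> K" if "n < k" for n
      using \<phi>(2) \<open>i < m\<close> \<open>j < m\<close> that by (auto simp: A_def)
    then show ?thesis unfolding V_def B_def using K Kpow' k by auto
  qed
  define \<chi> where "\<chi> i j = \<gamma> (V i j)" for i j
  have "\<chi> i j < card B" if "i < m" "j < m" for i j
    using VB[OF that] \<gamma>(2) by (auto simp: \<chi>_def)
  moreover have "real (card B) \<le> 2 ^ k * real m powr (1 - 1 / real k)"
  proof -
    define q :: real where "q = 2 ^ r"
    have q: "q > 0" "q ^ k \<le> 2 ^ k * real m"
      using r2 by (simp_all add: q_def flip: of_nat_le_iff[where ?'a = real])
    have "real (card B) = q ^ (k - 1)" by (simp add: B q_def)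
    also have "\<dots> = q powr real (k - 1)" using q(1) by (simp add: powr_realpow)
    also have "real (k - 1) = real k * (1 - 1 / real k)" using k by auto
    also have "q powr (real k * (1 - 1 / real k)) = (q powr real k) powr (1 - 1 / real k)"
      by (simp only: powr_powr)
    also have "q powr real k = q ^ k" using q(1) by (simp add: powr_realpow)
    also have "(q ^ k) powr (1 - 1 / real k) \<le> (2 ^ k * real m) powr (1 - 1 / real k)"
      using q k by (intro powr_mono2) auto
    also have "\<dots> = (2 ^ k) powr (1 - 1 / real k) * real m powr (1 - 1 / real k)"
      by (simp add: powr_mult)
    also have "\<dots> \<le> (2 ^ k) powr 1 * real m powr (1 - 1 / real k)"
      using k by (intro mult_right_mono powr_mono) auto
    finally show ?thesis by simp
  qed
  moreover have "\<exists>i<k. \<not> (p i < m \<and> l i < m \<and> p i \<noteq> p (Suc i mod k) \<and> l i \<noteq> l (Suc i mod k) \<and>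
       \<chi> (p i) (l i) = c \<and> \<chi> (p (Suc i mod k)) (l i) = c)" for p l c
  proof (rule ccontr)
    assume contr: "\<not> ?thesis"
    have s: "Suc i mod k < k" for i using k by auto
    have pl: "p i < m" "l i < m" "p i \<noteq> p (Suc i mod k)" "l i \<noteq> l (Suc i mod k)"
      "\<chi> (p i) (l i) = c" "\<chi> (p (Suc i mod k)) (l i) = c" if "i < k" for i
      using contr that by blast+
    define C where "C = V (p 0) (l 0)"
    have k0: "0 < k" using k by auto
    have VC: "V i j = C" if "\<chi> i j = c" "i < m" "j < m" for i j
    proof -
      have "\<gamma> (V i j) = \<gamma> C" using pl(5)[OF k0] that by (simp add: C_def \<chi>_def)
      then show ?thesis using VB that pl[OF k0] inj_onD[OF \<gamma>(1)] by (simp add: C_def)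
    qed
    have Vn: "\<phi> i n + \<phi> j n - \<phi> i 0 * \<phi> j 0 ^ n = C n" if "V i j = C" "1 \<le> n" "n < k" for i j n
      using that(2,3) unfolding that(1)[symmetric] V_def by simp
    have ne: "\<exists>n<k. \<phi> i n \<noteq> \<phi> j n" if "i < m" "j < m" "i \<noteq> j" for i j
    proof (rule ccontr)
      assume "\<not> ?thesis"
      moreover have "\<phi> i \<in> A" "\<phi> j \<in> A" using \<phi>(2) that by auto
      ultimately have "\<phi> i = \<phi> j" unfolding A_def by (intro PiE_ext) auto
      then show False using \<phi>(1) that by (auto simp: inj_on_def)
    qed
    show False
    proof (rule wenger_no_closed_walk[OF k, where P = "\<lambda>i. \<phi> (p i)" and L = "\<lambda>i. \<phi> (l i)" and C = C])
      show "\<phi> (p i) n + \<phi> (l i) n - \<phi> (p i) 0 * \<phi> (l i) 0 ^ n = C n" if "i < k" "1 \<le> n" "n < k" for i n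
        by (intro Vn VC pl that)
      show "\<phi> (p (Suc i mod k)) n + \<phi> (l i) n - \<phi> (p (Suc i mod k)) 0 * \<phi> (l i) 0 ^ n = C n"
        if "i < k" "1 \<le> n" "n < k" for i n
        by (intro Vn VC pl that s)
      show "\<exists>n<k. \<phi> (p i) n \<noteq> \<phi> (p (Suc i mod k)) n" if "i < k" for i
        by (intro ne pl that s)
      show "\<exists>n<k. \<phi> (l i) n \<noteq> \<phi> (l (Suc i mod k)) n" if "i < k" for i
        by (intro ne pl that s)
    qed
  qed
  ultimately show ?thesis by (intro exI[of _ \<chi>] exI[of _ "card B"]) blast
qed

section \<open>The local lemma and random colourings\<close>

text \<open>The symmetric local lemma in counting form; \<open>b J u / g J\<close> is a conditional
  probability. It stays below \<open>2 * p\<close> by induction: dropping the at most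
  \<open>d\<close> conditions in \<open>\<Gamma> u\<close> costs a factor of at most 2, since
  \<open>2 * p * d \<le> 1 / 2\<close>. The hypothesis \<open>indep\<close> is an inequality, not
  independence, which is the form that \<open>card_bad_le\<close> delivers.\<close>

lemma lovasz_local_lemma:
  fixes \<Omega> :: "'b set" and B :: "'i \<Rightarrow> 'b \<Rightarrow> bool" and p :: real
  assumes fin: "finite \<Omega>" "\<Omega> \<noteq> {}" "finite I"
    and \<Gamma>: "\<And>u. u \<in> I \<Longrightarrow> finite (\<Gamma> u) \<and> card (\<Gamma> u) \<le> d"
    and p: "0 \<le> p" "p < 1 / 2" "4 * p * real d \<le> 1"
    and indep: "\<And>u J. u \<in> I \<Longrightarrow> J \<subseteq> I \<Longrightarrow> J \<inter> \<Gamma> u = {} \<Longrightarrow>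
      real (card {\<phi> \<in> \<Omega>. (\<forall>w\<in>J. \<not> B w \<phi>) \<and> B u \<phi>}) \<le> p * real (card {\<phi> \<in> \<Omega>. \<forall>w\<in>J. \<not> B w \<phi>})"
  shows "\<exists>\<phi>\<in>\<Omega>. \<forall>u\<in>I. \<not> B u \<phi>"
proof -
  define g where "g J = real (card {\<phi> \<in> \<Omega>. \<forall>w\<in>J. \<not> B w \<phi>})" for J
  define b where "b J u = real (card {\<phi> \<in> \<Omega>. (\<forall>w\<in>J. \<not> B w \<phi>) \<and> B u \<phi>})" for J u
  have g_insert: "g (insert u J) = g J - b J u" for u J
  proof -
    have "{\<phi> \<in> \<Omega>. \<forall>w\<in>J. \<not> B w \<phi>} =
      {\<phi> \<in> \<Omega>. \<forall>w\<in>insert u J. \<not> B w \<phi>} \<union> {\<phi> \<in> \<Omega>. (\<forall>w\<in>J. \<not> B w \<phi>) \<and> B u \<phi>}" by auto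
    then have "g J = g (insert u J) + b J u"
      unfolding g_def b_def using fin by (subst of_nat_add[symmetric], subst card_Un_disjoint[symmetric]) auto
    then show ?thesis by simp
  qed
  have g_mono: "g J' \<le> g J" if "J \<subseteq> J'" for J J'
    unfolding g_def of_nat_le_iff using fin that by (intro card_mono) auto
  have b_mono: "b J' u \<le> b J u" if "J \<subseteq> J'" for J J' u
    unfolding b_def of_nat_le_iff using fin that by (intro card_mono) auto
  have g0: "0 \<le> g J" for J by (simp add: g_def)
  have key: "J \<subseteq> I \<Longrightarrow> u \<in> I \<Longrightarrow> b J u \<le> 2 * p * g J" for J u
  proof (induction "card J" arbitrary: J u rule: less_induct)
    case less
    have finJ: "finite J" using less.prems fin finite_subset by blast
    define J1 where "J1 = J \<inter> \<Gamma> u"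
    define J2 where "J2 = J - \<Gamma> u"
    have "finite J1" using finJ by (simp add: J1_def)
    have "(1 - 2 * p * real (card M)) * g J2 \<le> g (J2 \<union> M)" if "finite M" "M \<subseteq> J1" for M
      using that
    proof (induction M)
      case (insert w M)
      have "J2 \<union> M \<subset> J" using insert by (auto simp: J1_def J2_def)
      then have "card (J2 \<union> M) < card J" using finJ by (rule psubset_card_mono[rotated])
      moreover have "J2 \<union> M \<subseteq> I" "w \<in> I"
        using \<open>J2 \<union> M \<subset> J\<close> insert.prems less.prems by (auto simp: J1_def)
      ultimately have "b (J2 \<union> M) w \<le> 2 * p * g (J2 \<union> M)" using less.hyps by blast
      also have "\<dots> \<le> 2 * p * g J2" using p g_mono[of J2 "J2 \<union> M"] by (intro mult_left_mono) auto
      finally have "b (J2 \<union> M) w \<le> 2 * p * g J2" .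
      moreover have "g (J2 \<union> insert w M) = g (J2 \<union> M) - b (J2 \<union> M) w"
        using g_insert[of w "J2 \<union> M"] by simp
      moreover have "(1 - 2 * p * real (card M)) * g J2 \<le> g (J2 \<union> M)" using insert by simp
      ultimately show ?case using insert.hyps by (simp add: algebra_simps)
    qed simp
    moreover have "J2 \<union> J1 = J" by (auto simp: J1_def J2_def)
    ultimately have 1: "(1 - 2 * p * real (card J1)) * g J2 \<le> g J"
      using \<open>finite J1\<close> by (metis order_refl)
    have "card J1 \<le> d"
      using \<Gamma>[OF less.prems(2)] card_mono[of "\<Gamma> u" J1] by (auto simp: J1_def)
    then have "2 * p * real (card J1) \<le> 2 * p * real d" using p by (intro mult_left_mono) auto
    then have "1 / 2 \<le> 1 - 2 * p * real (card J1)" using p(3) by linarith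
    then have "1 / 2 * g J2 \<le> g J" using 1 g0[of J2] by (meson mult_right_mono order_trans)
    then have 2: "p * g J2 \<le> p * (2 * g J)" using p by (intro mult_left_mono) auto
    have "b J u \<le> b J2 u" by (rule b_mono) (auto simp: J2_def)
    also have "\<dots> \<le> p * g J2" unfolding b_def g_def
      by (rule indep) (use less.prems in \<open>auto simp: J2_def\<close>)
    finally show ?case using 2 by simp
  qed
  have "J \<subseteq> I \<Longrightarrow> 0 < g J" if "finite J" for J
    using that
  proof (induction J)
    case empty
    then show ?case using fin by (simp add: g_def card_gt_0_iff)
  next
    case (insert u J)
    then have "b J u \<le> 2 * p * g J" "0 < g J" using key by auto
    moreover have "2 * p * g J < g J"
      using mult_strict_right_mono[of "2 * p" 1 "g J"] p(2) \<open>0 < g J\<close> by simp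
    ultimately have "b J u < g J" by linarith
    then show ?case by (simp add: g_insert)
  qed
  from this[OF fin(3)] have "{\<phi> \<in> \<Omega>. \<forall>w\<in>I. \<not> B w \<phi>} \<noteq> {}" by (auto simp: g_def card_gt_0_iff)
  then show ?thesis by auto
qed

text \<open>Exchanging the colour of \<open>v\<close> with the fresh colour \<open>c\<close> is an
  involution on pairs.\<close>

lemma sum_resample:
  fixes G :: "('a \<Rightarrow> nat) \<Rightarrow> real"
  assumes "v \<in> V"
  shows "real n * (\<Sum>\<phi>\<in>V \<rightarrow>\<^sub>E {..<n}. G \<phi>) = (\<Sum>\<phi>\<in>V \<rightarrow>\<^sub>E {..<n}. \<Sum>c<n. G (\<phi>(v := c)))"
proof -
  have "(\<Sum>\<phi>\<in>V \<rightarrow>\<^sub>E {..<n}. \<Sum>c<n. G (\<phi>(v := c))) =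
    (\<Sum>(\<phi>, c)\<in>(V \<rightarrow>\<^sub>E {..<n}) \<times> {..<n}. G (\<phi>(v := c)))"
    by (simp add: sum.cartesian_product)
  also have "\<dots> = (\<Sum>(\<phi>, c)\<in>(V \<rightarrow>\<^sub>E {..<n}) \<times> {..<n}. G \<phi>)"
    by (rule sum.reindex_bij_witness[where i = "\<lambda>(\<phi>, c). (\<phi>(v := c), \<phi> v)" and j = "\<lambda>(\<phi>, c). (\<phi>(v := c), \<phi> v)"])
      (use assms in \<open>auto simp: PiE_iff extensional_def\<close>)
  also have "\<dots> = real n * (\<Sum>\<phi>\<in>V \<rightarrow>\<^sub>E {..<n}. G \<phi>)"
    by (simp add: sum.cartesian_product[symmetric] sum_distrib_left)
  finally show ?thesis ..
qed

text \<open>One exposure step: with all other colours fixed, at most \<open>h\<close> of the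
  \<open>n\<close> colours of \<open>v\<close> receive the weight \<open>z\<close>.\<close>

lemma sum_weighted_hit_le:
  fixes F :: "('a \<Rightarrow> nat) \<Rightarrow> real" and Y :: "('a \<Rightarrow> nat) \<Rightarrow> nat set"
  assumes v: "v \<in> V" and n: "n > 0" and z: "z \<ge> 0"
    and F: "\<And>\<phi>. F \<phi> \<ge> 0" "\<And>\<phi> c. F (\<phi>(v := c)) = F \<phi>"
    and Y: "\<And>\<phi> c. Y (\<phi>(v := c)) = Y \<phi>" "\<And>\<phi>. finite (Y \<phi>) \<and> card (Y \<phi>) \<le> h"
  shows "(\<Sum>\<phi>\<in>V \<rightarrow>\<^sub>E {..<n}. F \<phi> * (if \<phi> v \<in> Y \<phi> then z else 1)) \<le>
    (1 + z * real h / real n) * (\<Sum>\<phi>\<in>V \<rightarrow>\<^sub>E {..<n}. F \<phi>)" (is "?S \<le> _")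
proof -
  have "real n * ?S = (\<Sum>\<phi>\<in>V \<rightarrow>\<^sub>E {..<n}. \<Sum>c<n. F \<phi> * (if c \<in> Y \<phi> then z else 1))"
    by (subst sum_resample[OF v]) (simp add: F Y)
  also have "\<dots> \<le> (\<Sum>\<phi>\<in>V \<rightarrow>\<^sub>E {..<n}. F \<phi> * (real n + z * real h))"
  proof (rule sum_mono)
    fix \<phi>
    have "(\<Sum>c<n. if c \<in> Y \<phi> then z else 1) \<le> (\<Sum>c<n. 1 + (if c \<in> Y \<phi> then z else 0))"
      by (rule sum_mono) auto
    also have "\<dots> = real n + z * real (card ({..<n} \<inter> Y \<phi>))"
      by (simp add: sum.distrib sum.inter_restrict[symmetric])
    also have "\<dots> \<le> real n + z * real h"
    proof -
      have "card ({..<n} \<inter> Y \<phi>) \<le> card (Y \<phi>)" using Y(2) by (intro card_mono) auto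
      then have "card ({..<n} \<inter> Y \<phi>) \<le> h" using Y(2)[of \<phi>] by linarith
      then show ?thesis using z by (intro add_left_mono mult_left_mono) auto
    qed
    finally show "(\<Sum>c<n. F \<phi> * (if c \<in> Y \<phi> then z else 1)) \<le> F \<phi> * (real n + z * real h)"
      unfolding sum_distrib_left[symmetric] by (intro mult_left_mono F)
  qed
  also have "\<dots> = real n * ((1 + z * real h / real n) * (\<Sum>\<phi>\<in>V \<rightarrow>\<^sub>E {..<n}. F \<phi>))"
  proof -
    have "real n * (1 + z * real h / real n) = real n + z * real h"
      using n by (simp add: distrib_left)
    then have "real n * ((1 + z * real h / real n) * T) = (real n + z * real h) * T" for T
      by (simp only: mult.assoc[symmetric])
    then show ?thesis by (simp only: sum_distrib_right[symmetric] mult.commute)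
  qed
  finally show ?thesis using n by simp
qed

text \<open>
  Exponential moment of the number of vertices \<open>v \<in> S\<close> whose colour lies in a forbidden set
  \<open>Y v \<phi>\<close> or repeats the colour of an earlier vertex of \<open>S\<close>: expose the colours in increasing order.
\<close>

lemma sum_power_hits_le:
  fixes Y :: "'a :: linorder \<Rightarrow> ('a \<Rightarrow> nat) \<Rightarrow> nat set" and z :: real
  assumes "finite N" "N \<subseteq> V" and n: "n > 0" and z: "z \<ge> 1"
    and Q: "\<And>\<phi> w c. w \<in> N \<Longrightarrow> Q (\<phi>(w := c)) = Q \<phi>"
    and Y: "\<And>v \<phi> w c. v \<in> N \<Longrightarrow> w \<in> N \<Longrightarrow> Y v (\<phi>(w := c)) = Y v \<phi>"
      "\<And>v \<phi>. v \<in> N \<Longrightarrow> finite (Y v \<phi>) \<and> card (Y v \<phi>) + card N \<le> h"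
  shows "S \<subseteq> N \<Longrightarrow> (\<Sum>\<phi>\<in>V \<rightarrow>\<^sub>E {..<n}. if Q \<phi> then
      z ^ card {v \<in> S. \<phi> v \<in> Y v \<phi> \<or> (\<exists>w\<in>S. w < v \<and> \<phi> w = \<phi> v)} else 0) \<le>
    (1 + z * real h / real n) ^ card S * (\<Sum>\<phi>\<in>V \<rightarrow>\<^sub>E {..<n}. if Q \<phi> then 1 else 0)"
proof -
  assume "S \<subseteq> N"
  have "finite S" using \<open>S \<subseteq> N\<close> assms(1) finite_subset by blast
  then show ?thesis using \<open>S \<subseteq> N\<close>
  proof (induction S rule: finite_linorder_max_induct)
    case empty
    then show ?case by (simp cong: if_cong)
  next
    case (insert m S)
    have S: "finite S" "S \<subseteq> N" "m \<in> N" "m \<notin> S" using insert by auto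
    define hit where "hit S \<phi> = {v \<in> S. \<phi> v \<in> Y v \<phi> \<or> (\<exists>w\<in>S. w < v \<and> \<phi> w = \<phi> v)}" for S \<phi>
    define F where "F \<phi> = (if Q \<phi> then z ^ card (hit S \<phi>) else 0)" for \<phi>
    have hit_upd: "hit S (\<phi>(m := c)) = hit S \<phi>" for \<phi> c
    proof -
      have "(\<phi>(m := c)) v = \<phi> v" "Y v (\<phi>(m := c)) = Y v \<phi>" if "v \<in> S" for v
        using that S Y(1)[of v m \<phi> c] by auto
      then show ?thesis unfolding hit_def by (intro Collect_cong) (metis (no_types, lifting))
    qed
    have hit_ins: "hit (insert m S) \<phi> = (if \<phi> m \<in> Y m \<phi> \<union> \<phi> ` S then insert m (hit S \<phi>) else hit S \<phi>)" for \<phi>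
    proof -
      have less: "w < m" if "w \<in> S" for w using insert.hyps(2) that by blast
      have "v \<in> hit (insert m S) \<phi> \<longleftrightarrow> v \<in> hit S \<phi> \<or> v = m \<and> \<phi> m \<in> Y m \<phi> \<union> \<phi> ` S" for v
      proof (cases "v = m")
        case True
        have "(\<exists>w\<in>insert m S. w < m \<and> \<phi> w = \<phi> m) \<longleftrightarrow> \<phi> m \<in> \<phi> ` S"
          unfolding image_iff using less less_irrefl by (metis insert_iff)
        then show ?thesis using True S(4) unfolding hit_def by simp
      next
        case False
        have "\<not> m < v" if "v \<in> S" using less[OF that] by simp
        then show ?thesis using False unfolding hit_def by auto
      qed
      then show ?thesis by auto
    qed
    have card_hit: "z ^ card (hit (insert m S) \<phi>) =
        z ^ card (hit S \<phi>) * (if \<phi> m \<in> Y m \<phi> \<union> \<phi> ` S then z else 1)" for \<phi>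
    proof -
      have "m \<notin> hit S \<phi>" "finite (hit S \<phi>)" using S by (auto simp: hit_def)
      then show ?thesis unfolding hit_ins by simp
    qed
    have "(\<Sum>\<phi>\<in>V \<rightarrow>\<^sub>E {..<n}. if Q \<phi> then z ^ card (hit (insert m S) \<phi>) else 0) =
      (\<Sum>\<phi>\<in>V \<rightarrow>\<^sub>E {..<n}. F \<phi> * (if \<phi> m \<in> Y m \<phi> \<union> \<phi> ` S then z else 1))"
      by (rule sum.cong) (simp_all add: F_def card_hit)
    also have "\<dots> \<le> (1 + z * real h / real n) * (\<Sum>\<phi>\<in>V \<rightarrow>\<^sub>E {..<n}. F \<phi>)"
    proof (rule sum_weighted_hit_le)
      show "F (\<phi>(m := c)) = F \<phi>" for \<phi> c
        unfolding F_def hit_upd using Q[OF S(3)] by simp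
      show "Y m (\<phi>(m := c)) \<union> (\<phi>(m := c)) ` S = Y m \<phi> \<union> \<phi> ` S" for \<phi> c
        using Y(1)[OF S(3) S(3)] S(4) by (metis fun_upd_image Diff_empty Diff_insert0)
      show "finite (Y m \<phi> \<union> \<phi> ` S) \<and> card (Y m \<phi> \<union> \<phi> ` S) \<le> h" for \<phi>
      proof -
        have "card (Y m \<phi> \<union> \<phi> ` S) \<le> card (Y m \<phi>) + card (\<phi> ` S)" by (rule card_Un_le)
        also have "card (\<phi> ` S) \<le> card S" using S by (intro card_image_le)
        also have "card S \<le> card N" using S assms(1) by (intro card_mono)
        finally show ?thesis using Y(2)[OF S(3), of \<phi>] S by auto
      qed
    qed (use S assms F_def in auto)
    also have "\<dots> \<le> (1 + z * real h / real n) *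
      ((1 + z * real h / real n) ^ card S * (\<Sum>\<phi>\<in>V \<rightarrow>\<^sub>E {..<n}. if Q \<phi> then 1 else 0))"
    proof (rule mult_left_mono)
      show "(\<Sum>\<phi>\<in>V \<rightarrow>\<^sub>E {..<n}. F \<phi>) \<le>
        (1 + z * real h / real n) ^ card S * (\<Sum>\<phi>\<in>V \<rightarrow>\<^sub>E {..<n}. if Q \<phi> then 1 else 0)"
        using insert.IH[OF S(2)] unfolding F_def hit_def .
    qed (use z n in auto)
    also have "\<dots> = (1 + z * real h / real n) ^ card (insert m S) *
      (\<Sum>\<phi>\<in>V \<rightarrow>\<^sub>E {..<n}. if Q \<phi> then 1 else 0)"
      using S by simp
    finally show ?case unfolding hit_def .
  qed
qed

text \<open>Minimise the total weight of monochromatic pairs. Recolouring \<open>v\<close> changes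
  only the pairs that contain \<open>v\<close>, so its colour has the least conflict weight among
  all \<open>n\<close>, at most the average. It serves for the second palette and, with two colours,
  for a cut.\<close>

lemma local_minimum_colouring:
  fixes m :: "'a \<Rightarrow> 'a \<Rightarrow> nat"
  assumes fin: "finite V" and n: "n > 0" and sym: "\<And>u v. m u v = m v u"
  shows "\<exists>\<psi>. (\<forall>v\<in>V. \<psi> v < n) \<and>
    (\<forall>v\<in>V. n * (\<Sum>w | w \<in> V - {v} \<and> \<psi> w = \<psi> v. m v w) \<le> (\<Sum>w\<in>V - {v}. m v w))"
proof -
  define \<Omega> where "\<Omega> = V \<rightarrow>\<^sub>E {..<n}"
  define E where "E \<psi> = (\<Sum>v\<in>V. \<Sum>w\<in>V. if w \<noteq> v \<and> \<psi> w = \<psi> v then m v w else 0)" for \<psi> :: "'a \<Rightarrow> nat"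
  define K where "K \<psi> v c = (\<Sum>w\<in>V - {v}. if \<psi> w = c then m v w else 0)" for \<psi> :: "'a \<Rightarrow> nat" and v c
  have fin\<Omega>: "finite \<Omega>" "\<Omega> \<noteq> {}" using fin n by (auto simp: \<Omega>_def finite_PiE PiE_eq_empty_iff lessThan_empty_iff)
  define \<psi> where "\<psi> = arg_min_on E \<Omega>"
  have \<psi>: "\<psi> \<in> \<Omega>" "\<And>\<psi>'. \<psi>' \<in> \<Omega> \<Longrightarrow> E \<psi> \<le> E \<psi>'"
    using arg_min_if_finite[OF fin\<Omega>, of E] by (auto simp: \<psi>_def not_less)
  have E: "E \<psi> = (\<Sum>u\<in>V - {v}. \<Sum>w\<in>V - {v}. if w \<noteq> u \<and> \<psi> w = \<psi> u then m u w else 0) + 2 * K \<psi> v (\<psi> v)"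
    if "v \<in> V" for v \<psi>
  proof -
    have V: "V = insert v (V - {v})" "v \<notin> V - {v}" using that by auto
    have ins: "(\<Sum>w\<in>V. f w) = f v + (\<Sum>w\<in>V - {v}. f w)" for f :: "'a \<Rightarrow> nat"
      using fin that by (rule sum.remove)
    have "E \<psi> = (\<Sum>w\<in>V. if w \<noteq> v \<and> \<psi> w = \<psi> v then m v w else 0) +
      (\<Sum>u\<in>V - {v}. \<Sum>w\<in>V. if w \<noteq> u \<and> \<psi> w = \<psi> u then m u w else 0)"
      unfolding E_def by (rule ins)
    also have "(\<Sum>w\<in>V. if w \<noteq> v \<and> \<psi> w = \<psi> v then m v w else 0) = K \<psi> v (\<psi> v)"
      by (subst ins) (auto simp: K_def intro!: sum.cong)
    also have "(\<Sum>u\<in>V - {v}. \<Sum>w\<in>V. if w \<noteq> u \<and> \<psi> w = \<psi> u then m u w else 0) =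
      (\<Sum>u\<in>V - {v}. (if \<psi> u = \<psi> v then m v u else 0) +
        (\<Sum>w\<in>V - {v}. if w \<noteq> u \<and> \<psi> w = \<psi> u then m u w else 0))"
      unfolding ins by (intro sum.cong) (auto simp: sym)
    also have "\<dots> = K \<psi> v (\<psi> v) + (\<Sum>u\<in>V - {v}. \<Sum>w\<in>V - {v}. if w \<noteq> u \<and> \<psi> w = \<psi> u then m u w else 0)"
      unfolding K_def by (rule sum.distrib)
    finally show ?thesis by simp
  qed
  have le: "K \<psi> v (\<psi> v) \<le> K \<psi> v c" if v: "v \<in> V" and c: "c < n" for v c
  proof -
    have "\<psi>(v := c) \<in> \<Omega>" using \<psi>(1) v c by (auto simp: \<Omega>_def PiE_iff extensional_def)
    then have "E \<psi> \<le> E (\<psi>(v := c))" by (rule \<psi>(2))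
    moreover have "(\<Sum>u\<in>V - {v}. \<Sum>w\<in>V - {v}. if w \<noteq> u \<and> (\<psi>(v := c)) w = (\<psi>(v := c)) u then m u w else 0) =
      (\<Sum>u\<in>V - {v}. \<Sum>w\<in>V - {v}. if w \<noteq> u \<and> \<psi> w = \<psi> u then m u w else 0)"
      by (intro sum.cong) auto
    moreover have "K (\<psi>(v := c)) v ((\<psi>(v := c)) v) = K \<psi> v c"
      unfolding K_def by (intro sum.cong) auto
    ultimately show ?thesis using E[OF v, of \<psi>] E[OF v, of "\<psi>(v := c)"] by linarith
  qed
  show ?thesis
  proof (intro exI[of _ \<psi>] conjI ballI)
    show "\<psi> v < n" if "v \<in> V" for v using \<psi>(1) that by (auto simp: \<Omega>_def)
    fix v assume v: "v \<in> V"
    have "(\<Sum>w | w \<in> V - {v} \<and> \<psi> w = \<psi> v. m v w) = K \<psi> v (\<psi> v)"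
      unfolding K_def using fin by (simp add: sum.inter_filter[symmetric])
    then have "n * (\<Sum>w | w \<in> V - {v} \<and> \<psi> w = \<psi> v. m v w) = (\<Sum>c<n. K \<psi> v (\<psi> v))" by simp
    also have "\<dots> \<le> (\<Sum>c<n. K \<psi> v c)" using le[OF v] by (intro sum_mono) auto
    also have "\<dots> = (\<Sum>w\<in>V - {v}. \<Sum>c<n. if \<psi> w = c then m v w else 0)"
      unfolding K_def by (rule sum.swap)
    also have "\<dots> \<le> (\<Sum>w\<in>V - {v}. m v w)" by (intro sum_mono) auto
    finally show "n * (\<Sum>w | w \<in> V - {v} \<and> \<psi> w = \<psi> v. m v w) \<le> (\<Sum>w\<in>V - {v}. m v w)" .
  qed
qed

section \<open>Star-injective vertex colourings\<close>

text \<open>The unit \<open>t\<close> is a sixteenth of the degree bound, so that the fractions of a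
  neighbourhood used as thresholds are integers. The linear order fixes the order in which colours
  are exposed.\<close>

locale bounded_degree_graph =
  fixes V :: "'a :: linorder set" and N :: "'a \<Rightarrow> 'a set" and t :: nat
  assumes finite_V: "finite V"
    and N_subset: "\<And>v. N v \<subseteq> V"
    and N_sym: "\<And>u v. u \<in> N v \<Longrightarrow> v \<in> N u"
    and N_card: "\<And>v. card (N v) \<le> 16 * t"
    and t_pos: "1 \<le> t"
begin

lemma finite_N: "finite (N v)"
  using finite_subset[OF N_subset finite_V] .

definition repeated :: "('a \<Rightarrow> nat) \<Rightarrow> 'a \<Rightarrow> 'a set" where
  "repeated \<phi> u = {v \<in> N u. \<exists>w\<in>N u - {v}. \<phi> w = \<phi> v}"

text \<open>The transpose of \<open>repeated\<close>: \<open>u\<close> lies in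
  \<open>conflicts \<phi> v\<close> exactly when \<open>v\<close> lies in
  \<open>repeated \<phi> u\<close>. Its size at \<open>v\<close> is governed by the one colour of
  \<open>v\<close> and is therefore not concentrated.\<close>

definition conflicts :: "('a \<Rightarrow> nat) \<Rightarrow> 'a \<Rightarrow> 'a set" where
  "conflicts \<phi> v = {u \<in> N v. \<exists>w\<in>N u - {v}. \<phi> w = \<phi> v}"

definition heavy :: "('a \<Rightarrow> nat) \<Rightarrow> 'a \<Rightarrow> bool" where
  "heavy \<phi> v \<longleftrightarrow> 2 * t \<le> card (conflicts \<phi> v)"

definition bad :: "'a \<Rightarrow> ('a \<Rightarrow> nat) \<Rightarrow> bool" where
  "bad u \<phi> \<longleftrightarrow> 2 * t \<le> card {v \<in> N u. v \<in> repeated \<phi> u \<or> heavy \<phi> v}"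

text \<open>Ends of walks with exactly three steps. Such walks may turn back, so \<open>N w\<close>
  is included; these are all the vertices whose colours \<open>bad w\<close> inspects.\<close>

definition ball3 :: "'a \<Rightarrow> 'a set" where
  "ball3 w = (\<Union>v\<in>N w. \<Union>u\<in>N v. N u)"

lemma bad_cong:
  assumes "\<And>x. x \<in> ball3 w \<Longrightarrow> \<phi> x = \<psi> x"
  shows "bad w \<phi> \<longleftrightarrow> bad w \<psi>"
proof -
  have N1: "\<phi> v = \<psi> v" if "v \<in> N w" for v
    using assms N_sym[OF that] that unfolding ball3_def by blast
  have N3: "\<phi> x = \<psi> x" if "v \<in> N w" "u \<in> N v" "x \<in> N u" for v u x
    using assms that unfolding ball3_def by blast
  have "repeated \<phi> w = repeated \<psi> w"
    unfolding repeated_def using N1 by auto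
  moreover have "conflicts \<phi> v = conflicts \<psi> v" if "v \<in> N w" for v
    unfolding conflicts_def using N1[OF that] N3[OF that] by auto
  ultimately show ?thesis unfolding bad_def heavy_def by (metis (mono_tags, lifting) Collect_cong)
qed

text \<open>
  The colours that make \<open>v\<close> heavy on account of vertices outside \<open>N u\<close> alone; they do not depend on
  the colours in \<open>N u\<close>, hence the events \<open>bad u\<close> can be bounded after conditioning on the rest.
\<close>

definition forbidden :: "nat \<Rightarrow> 'a \<Rightarrow> 'a \<Rightarrow> ('a \<Rightarrow> nat) \<Rightarrow> nat set" where
  "forbidden n u v \<phi> = {c. c < n \<and> 2 * t \<le> card {u' \<in> N v. c \<in> \<phi> ` (N u' - N u)}}"

text \<open>Double counting of colours against vertices of \<open>N v\<close>: a forbidden colour is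
  seen at \<open>2 * t\<close> of them or more, and each sees at most \<open>16 * t\<close>
  colours.\<close>

lemma card_forbidden: "finite (forbidden n u v \<phi>) \<and> card (forbidden n u v \<phi>) \<le> 128 * t"
proof -
  have fin: "finite (forbidden n u v \<phi>)" by (simp add: forbidden_def)
  have "2 * t * card (forbidden n u v \<phi>) = (\<Sum>c\<in>forbidden n u v \<phi>. 2 * t)" by simp
  also have "\<dots> \<le> (\<Sum>c\<in>forbidden n u v \<phi>. card {u' \<in> N v. c \<in> \<phi> ` (N u' - N u)})"
    by (rule sum_mono) (simp add: forbidden_def)
  also have "\<dots> = (\<Sum>u'\<in>N v. card {c \<in> forbidden n u v \<phi>. c \<in> \<phi> ` (N u' - N u)})"
    by (rule sum_multicount_gen) (use fin finite_N in auto)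
  also have "\<dots> \<le> (\<Sum>u'\<in>N v. 16 * t)"
  proof (rule sum_mono)
    fix u'
    have "card {c \<in> forbidden n u v \<phi>. c \<in> \<phi> ` (N u' - N u)} \<le> card (\<phi> ` N u')"
      using finite_N by (intro card_mono) auto
    also have "\<dots> \<le> card (N u')" using finite_N by (rule card_image_le)
    finally show "card {c \<in> forbidden n u v \<phi>. c \<in> \<phi> ` (N u' - N u)} \<le> 16 * t"
      using N_card[of u'] by simp
  qed
  also have "\<dots> \<le> 16 * t * (16 * t)" using N_card[of v] by simp
  finally have "2 * t * card (forbidden n u v \<phi>) \<le> 2 * t * (128 * t)" by simp
  then show ?thesis using t_pos fin by simp
qed

text \<open>A heavy vertex whose colour is not repeated in \<open>N u\<close> owes all its conflicts
  to vertices outside \<open>N u\<close>, so its colour is forbidden. A repeated vertex that is no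
  hit is the first of its colour in \<open>N u\<close>, and a later one of that colour is a hit.
  This injects the remaining vertices into the hits, so at least half of the \<open>2 * t\<close>
  vertices are hits.\<close>

lemma bad_imp_hits:
  assumes \<phi>: "\<And>v. v \<in> V \<Longrightarrow> \<phi> v < n" and bad: "bad u \<phi>"
  shows "t \<le> card {v \<in> N u. \<phi> v \<in> forbidden n u v \<phi> \<or> (\<exists>w\<in>N u. w < v \<and> \<phi> w = \<phi> v)}"
    (is "_ \<le> card ?H")
proof -
  define Z where "Z = {v \<in> N u. v \<in> repeated \<phi> u \<or> heavy \<phi> v}"
  have fin: "finite ?H" "finite Z" using finite_N by (auto simp: Z_def)
  have "\<exists>w\<in>?H. v < w \<and> \<phi> w = \<phi> v" if v: "v \<in> Z - ?H" for v
  proof -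
    have vN: "v \<in> N u" using v by (auto simp: Z_def)
    have "v \<in> repeated \<phi> u"
    proof (rule ccontr)
      assume nr: "v \<notin> repeated \<phi> u"
      then have "heavy \<phi> v" using v by (auto simp: Z_def)
      moreover have "conflicts \<phi> v \<subseteq> {u' \<in> N v. \<phi> v \<in> \<phi> ` (N u' - N u)}"
      proof
        fix x assume "x \<in> conflicts \<phi> v"
        then obtain w where w: "x \<in> N v" "w \<in> N x" "w \<noteq> v" "\<phi> w = \<phi> v"
          by (auto simp: conflicts_def)
        have "w \<notin> N u" using nr vN w unfolding repeated_def by blast
        then show "x \<in> {u' \<in> N v. \<phi> v \<in> \<phi> ` (N u' - N u)}" using w by (auto intro!: image_eqI[where x = w])
      qed
      then have "card (conflicts \<phi> v) \<le> card {u' \<in> N v. \<phi> v \<in> \<phi> ` (N u' - N u)}"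
        using finite_N by (intro card_mono) auto
      ultimately have "\<phi> v \<in> forbidden n u v \<phi>"
        using \<phi> vN N_subset by (auto simp: forbidden_def heavy_def)
      then show False using v vN by auto
    qed
    then obtain w where w: "w \<in> N u" "w \<noteq> v" "\<phi> w = \<phi> v" by (auto simp: repeated_def)
    then have "v < w" using v vN by force
    moreover have "w \<in> ?H" using w vN \<open>v < w\<close> by force
    ultimately show ?thesis using w by blast
  qed
  then have "\<forall>v\<in>Z - ?H. \<exists>w. w \<in> ?H \<and> v < w \<and> \<phi> w = \<phi> v" by blast
  from bchoice[OF this] obtain g
    where g: "\<And>v. v \<in> Z - ?H \<Longrightarrow> g v \<in> ?H \<and> v < g v \<and> \<phi> (g v) = \<phi> v" by blast
  have "inj_on g (Z - ?H)"
  proof (rule inj_onI, rule ccontr)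
    fix v v' assume v: "v \<in> Z - ?H" "v' \<in> Z - ?H" and eq: "g v = g v'" "v \<noteq> v'"
    have "\<phi> v = \<phi> v'" using g[OF v(1)] g[OF v(2)] eq by simp
    moreover have "v \<in> N u" "v' \<in> N u" using v by (auto simp: Z_def)
    ultimately have "v \<in> ?H \<or> v' \<in> ?H" using eq(2) by (cases "v < v'") force+
    then show False using v by blast
  qed
  then have "card (Z - ?H) \<le> card ?H"
    by (rule card_inj_on_le) (use g fin in auto)
  moreover have "card Z \<le> card (Z - ?H) + card ?H"
    using card_mono[of "(Z - ?H) \<union> ?H" Z] card_Un_le[of "Z - ?H" ?H] fin by fastforce
  moreover have "2 * t \<le> card Z" using bad by (simp add: bad_def Z_def)
  ultimately show ?thesis by linarith
qed

text \<open>
  Here \<open>144 * t\<close> bounds the colours that are a hit for a given vertex: \<open>128 * t\<close> forbidden ones and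
  at most \<open>16 * t\<close> already used in \<open>N u\<close>. The factor \<open>2 ^ 38\<close> leaves a probability \<open>2 ^ (- 22 * t)\<close>
  small enough for the local lemma with \<open>(16 * t) ^ 4\<close> dependent events, whatever \<open>t\<close> is.
\<close>

lemma card_bad_le:
  assumes n: "n = 2 ^ 38 * (144 * t)" and Q: "\<And>\<phi> w c. w \<in> N u \<Longrightarrow> Q (\<phi>(w := c)) = Q \<phi>"
  shows "real (card {\<phi> \<in> V \<rightarrow>\<^sub>E {..<n}. Q \<phi> \<and> bad u \<phi>}) \<le>
    1 / 2 ^ (22 * t) * real (card {\<phi> \<in> V \<rightarrow>\<^sub>E {..<n}. Q \<phi>})"
proof -
  let ?\<Omega> = "V \<rightarrow>\<^sub>E {..<n}"
  define H where "H \<phi> = {v \<in> N u. \<phi> v \<in> forbidden n u v \<phi> \<or> (\<exists>w\<in>N u. w < v \<and> \<phi> w = \<phi> v)}" for \<phi>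
  have fin: "finite ?\<Omega>" using finite_V by (simp add: finite_PiE)
  have n0: "n > 0" using n t_pos by simp
  \<comment> \<open>Markov's inequality with this base: the choice of \<open>n\<close> makes every
    factor of the exponential moment equal to 2, and 38 - 16 = 22 remains in the exponent.\<close>
  define z :: real where "z = 2 ^ 38"
  have zh: "1 + z * real (144 * t) / real n = 2" using n t_pos by (simp add: z_def)
  have "real (card {\<phi> \<in> ?\<Omega>. Q \<phi> \<and> bad u \<phi>}) * z ^ t = (\<Sum>\<phi>\<in>{\<phi> \<in> ?\<Omega>. Q \<phi> \<and> bad u \<phi>}. z ^ t)" by simp
  also have "\<dots> \<le> (\<Sum>\<phi>\<in>{\<phi> \<in> ?\<Omega>. Q \<phi> \<and> bad u \<phi>}. if Q \<phi> then z ^ card (H \<phi>) else 0)"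
  proof (rule sum_mono)
    fix \<phi> assume "\<phi> \<in> {\<phi> \<in> ?\<Omega>. Q \<phi> \<and> bad u \<phi>}"
    then have "t \<le> card (H \<phi>)" "Q \<phi>"
      unfolding H_def using bad_imp_hits[of \<phi> n u] by auto
    then show "z ^ t \<le> (if Q \<phi> then z ^ card (H \<phi>) else 0)"
      by (simp add: z_def power_increasing)
  qed
  also have "\<dots> \<le> (\<Sum>\<phi>\<in>?\<Omega>. if Q \<phi> then z ^ card (H \<phi>) else 0)"
    using fin by (intro sum_mono2) (auto simp: z_def)
  also have "\<dots> \<le> (1 + z * real (144 * t) / real n) ^ card (N u) * (\<Sum>\<phi>\<in>?\<Omega>. if Q \<phi> then 1 else 0)"
    unfolding H_def
  proof (rule sum_power_hits_le[where N = "N u"])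
    show "forbidden n u v (\<phi>(w := c)) = forbidden n u v \<phi>" if "w \<in> N u" for v \<phi> w c
    proof -
      have "(\<phi>(w := c)) ` (N u' - N u) = \<phi> ` (N u' - N u)" for u'
        using that by (intro image_cong) auto
      then show ?thesis by (simp add: forbidden_def)
    qed
    show "finite (forbidden n u v \<phi>) \<and> card (forbidden n u v \<phi>) + card (N u) \<le> 144 * t" for v \<phi>
      using card_forbidden[of n u v \<phi>] N_card[of u] by simp
  qed (use finite_N N_subset n0 Q in \<open>auto simp: z_def\<close>)
  also have "\<dots> = 2 ^ card (N u) * real (card {\<phi> \<in> ?\<Omega>. Q \<phi>})"
    unfolding zh using fin by (simp add: sum.inter_filter[symmetric])
  also have "\<dots> \<le> 2 ^ (16 * t) * real (card {\<phi> \<in> ?\<Omega>. Q \<phi>})"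
    using N_card by (intro mult_right_mono power_increasing) auto
  finally have 1: "real (card {\<phi> \<in> ?\<Omega>. Q \<phi> \<and> bad u \<phi>}) * z ^ t \<le>
    2 ^ (16 * t) * real (card {\<phi> \<in> ?\<Omega>. Q \<phi>})" .
  have "z ^ t = 2 ^ (16 * t) * 2 ^ (22 * t)"
    unfolding z_def power_mult[symmetric] power_add[symmetric] by (simp add: algebra_simps)
  then have "2 ^ (16 * t) * (real (card {\<phi> \<in> ?\<Omega>. Q \<phi> \<and> bad u \<phi>}) * 2 ^ (22 * t)) \<le>
    2 ^ (16 * t) * real (card {\<phi> \<in> ?\<Omega>. Q \<phi>})"
    using 1 by (simp add: mult_ac)
  then have "real (card {\<phi> \<in> ?\<Omega>. Q \<phi> \<and> bad u \<phi>}) * 2 ^ (22 * t) \<le> real (card {\<phi> \<in> ?\<Omega>. Q \<phi>})"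
    by simp
  then show ?thesis by (simp add: field_simps)
qed

lemma card_UN_N: "finite A \<Longrightarrow> card (\<Union>v\<in>A. N v) \<le> card A * (16 * t)"
  using card_UN_le[of A N] sum_bounded_above[of A "\<lambda>v. card (N v)" "16 * t"] N_card by fastforce

text \<open>Recolouring a vertex of \<open>N u\<close> affects \<open>bad w\<close> only when
  \<open>w\<close> is reached from \<open>u\<close> by a walk of four steps. For \<open>J\<close>
  outside that set, the condition that no \<open>w\<close> in \<open>J\<close> is bad can therefore
  serve as \<open>Q\<close> in \<open>card_bad_le\<close>.\<close>

lemma exists_good_colouring:
  assumes n: "n = 2 ^ 38 * (144 * t)"
  shows "\<exists>\<phi>\<in>V \<rightarrow>\<^sub>E {..<n}. \<forall>u\<in>V. \<not> bad u \<phi>"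
proof (rule lovasz_local_lemma)
  define \<Gamma> where "\<Gamma> u = (\<Union>v\<in>(\<Union>v\<in>(\<Union>v\<in>N u. N v). N v). N v)" for u
  define d where "d = 16 * t * (16 * t) * (16 * t) * (16 * t)"
  show "finite (\<Gamma> u) \<and> card (\<Gamma> u) \<le> d" for u
  proof -
    define A1 where "A1 = (\<Union>v\<in>N u. N v)"
    define A2 where "A2 = (\<Union>v\<in>A1. N v)"
    have A1: "finite A1" using finite_N by (auto simp: A1_def)
    have A2: "finite A2" using finite_N A1 by (auto simp: A2_def)
    have A3: "finite (\<Gamma> u)" using finite_N A2 by (auto simp: \<Gamma>_def A2_def A1_def)
    have "card A1 \<le> card (N u) * (16 * t)" unfolding A1_def using finite_N by (rule card_UN_N)
    also have "\<dots> \<le> 16 * t * (16 * t)" using N_card by (intro mult_right_mono) auto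
    finally have c1: "card A1 \<le> 16 * t * (16 * t)" .
    have "card A2 \<le> card A1 * (16 * t)" unfolding A2_def using A1 by (rule card_UN_N)
    also have "\<dots> \<le> 16 * t * (16 * t) * (16 * t)" using c1 by (intro mult_right_mono) auto
    finally have c2: "card A2 \<le> 16 * t * (16 * t) * (16 * t)" .
    have "card (\<Gamma> u) \<le> card A2 * (16 * t)"
      unfolding \<Gamma>_def A1_def[symmetric] A2_def[symmetric] using A2 by (rule card_UN_N)
    also have "\<dots> \<le> d" unfolding d_def using c2 by (intro mult_right_mono) auto
    finally have c3: "card (\<Gamma> u) \<le> d" .
    then show ?thesis using A3 by simp
  qed
  \<comment> \<open>Here \<open>4 * d\<close> is \<open>2 ^ 18 * t ^ 4\<close>, and
    \<open>t \<le> 2 ^ t\<close> and \<open>18 \<le> 18 * t\<close> give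
    \<open>2 ^ (22 * t)\<close>.\<close>
  show "4 * (1 / 2 ^ (22 * t)) * real d \<le> 1"
  proof -
    have "t ^ 4 \<le> (2 ^ t) ^ 4" by (intro power_mono) simp_all
    then have "2 ^ 18 * t ^ 4 \<le> 2 ^ 18 * 2 ^ (4 * t)" by (simp add: power_mult[symmetric] mult.commute)
    also have "\<dots> \<le> 2 ^ (18 * t) * 2 ^ (4 * t)"
      using t_pos by (intro mult_right_mono power_increasing) auto
    also have "\<dots> = (2 :: nat) ^ (22 * t)" by (simp add: power_add[symmetric])
    also have "2 ^ 18 * t ^ 4 = 4 * d" by (simp add: d_def power4_eq_xxxx)
    finally have "real (4 * d) \<le> real (2 ^ (22 * t))" unfolding of_nat_le_iff .
    then show ?thesis by (simp add: field_simps)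
  qed
  show "1 / 2 ^ (22 * t) < (1 / 2 :: real)"
  proof -
    have "(2 :: real) ^ 1 < 2 ^ (22 * t)" using t_pos by (intro power_strict_increasing) auto
    then show ?thesis by (simp add: field_simps)
  qed
  show "real (card {\<phi> \<in> V \<rightarrow>\<^sub>E {..<n}. (\<forall>w\<in>J. \<not> bad w \<phi>) \<and> bad u \<phi>}) \<le>
    1 / 2 ^ (22 * t) * real (card {\<phi> \<in> V \<rightarrow>\<^sub>E {..<n}. \<forall>w\<in>J. \<not> bad w \<phi>})"
    if J: "J \<inter> \<Gamma> u = {}" for u J
  proof (rule card_bad_le[OF n])
    fix \<phi> y c assume y: "y \<in> N u"
    have "bad w (\<phi>(y := c)) \<longleftrightarrow> bad w \<phi>" if "w \<in> J" for w
    proof (rule bad_cong)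
      fix x assume "x \<in> ball3 w"
      have "y \<notin> ball3 w"
      proof
        assume "y \<in> ball3 w"
        then obtain v u' where "v \<in> N w" "u' \<in> N v" "y \<in> N u'" by (auto simp: ball3_def)
        then have "w \<in> \<Gamma> u" using y N_sym unfolding \<Gamma>_def by blast
        then show False using J that by blast
      qed
      then show "(\<phi>(y := c)) x = \<phi> x" using \<open>x \<in> ball3 w\<close> by auto
    qed
    then show "(\<forall>w\<in>J. \<not> bad w (\<phi>(y := c))) = (\<forall>w\<in>J. \<not> bad w \<phi>)" by blast
  qed
  have "n > 0" using n t_pos by simp
  then show "V \<rightarrow>\<^sub>E {..<n} \<noteq> {}" by (auto simp: PiE_eq_empty_iff lessThan_empty_iff)
qed (use finite_V in \<open>auto simp: finite_PiE\<close>)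

text \<open>
  Heavy vertices get a second palette. They make up a small part of every neighbourhood, so there
  a colouring with a locally minimal number of conflicts suffices.
\<close>

lemma exists_star_injective_colouring:
  assumes n: "n = 2 ^ 38 * (144 * t)"
  shows "\<exists>\<kappa>. (\<forall>v\<in>V. \<kappa> v < 2 * n) \<and>
    (\<forall>x\<in>V. card {y \<in> N x. (\<exists>w\<in>N x - {y}. \<kappa> w = \<kappa> y) \<or> (\<exists>w\<in>N y - {x}. \<kappa> w = \<kappa> x)} \<le> 4 * t)"
proof -
  obtain \<phi> where \<phi>: "\<phi> \<in> V \<rightarrow>\<^sub>E {..<n}" "\<And>u. u \<in> V \<Longrightarrow> \<not> bad u \<phi>"
    using exists_good_colouring[OF n] by blast
  define U where "U = {v \<in> V. heavy \<phi> v}"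
  have finU: "finite U" using finite_V by (simp add: U_def)
  have n0: "16 * t \<le> n" "n > 0" using n t_pos by auto
  have cU: "card {v \<in> N u. v \<in> repeated \<phi> u \<or> v \<in> U} < 2 * t" if "u \<in> V" for u
  proof -
    have "{v \<in> N u. v \<in> repeated \<phi> u \<or> v \<in> U} = {v \<in> N u. v \<in> repeated \<phi> u \<or> heavy \<phi> v}"
      using N_subset by (auto simp: U_def)
    then show ?thesis using \<phi>(2)[OF that] by (simp add: bad_def not_le)
  qed
  \<comment> \<open>The weight counts common neighbours: giving \<open>v\<close> and
    \<open>w\<close> the same colour spoils precisely the edges from them to those.\<close>
  have "\<exists>\<psi>. (\<forall>v\<in>U. \<psi> v < n) \<and>
    (\<forall>v\<in>U. n * (\<Sum>w | w \<in> U - {v} \<and> \<psi> w = \<psi> v. card (N v \<inter> N w)) \<le> (\<Sum>w\<in>U - {v}. card (N v \<inter> N w)))"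
    by (rule local_minimum_colouring) (use finU n0 in \<open>auto simp: Int_commute\<close>)
  then obtain \<psi> where \<psi>: "\<And>v. v \<in> U \<Longrightarrow> \<psi> v < n"
    "\<And>v. v \<in> U \<Longrightarrow> n * (\<Sum>w | w \<in> U - {v} \<and> \<psi> w = \<psi> v. card (N v \<inter> N w)) \<le> (\<Sum>w\<in>U - {v}. card (N v \<inter> N w))"
    by blast
  define \<kappa> where "\<kappa> v = (if v \<in> U then n + \<psi> v else \<phi> v)" for v
  have \<phi>n: "\<phi> v < n" if "v \<in> V" for v using \<phi>(1) that by auto
  have \<kappa>_eq: "(v \<in> U \<longleftrightarrow> w \<in> U) \<and> (v \<in> U \<longrightarrow> \<psi> v = \<psi> w) \<and> (v \<notin> U \<longrightarrow> \<phi> v = \<phi> w)"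
    if "\<kappa> v = \<kappa> w" "v \<in> V" "w \<in> V" for v w
    using that \<phi>n[of v] \<phi>n[of w] by (auto simp: \<kappa>_def split: if_splits)
  have "card {y \<in> N x. (\<exists>w\<in>N x - {y}. \<kappa> w = \<kappa> y) \<or> (\<exists>w\<in>N y - {x}. \<kappa> w = \<kappa> x)} \<le> 4 * t"
    if x: "x \<in> V" for x
  proof -
    define B1 where "B1 = {y \<in> N x. \<exists>w\<in>N x - {y}. \<kappa> w = \<kappa> y}"
    define B2 where "B2 = {y \<in> N x. \<exists>w\<in>N y - {x}. \<kappa> w = \<kappa> x}"
    have "B1 \<subseteq> {v \<in> N x. v \<in> repeated \<phi> x \<or> v \<in> U}"
    proof
      fix y assume "y \<in> B1"
      then obtain w where w: "y \<in> N x" "w \<in> N x - {y}" "\<kappa> w = \<kappa> y" by (auto simp: B1_def)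
      have "w \<in> V" "y \<in> V" using w N_subset by auto
      then show "y \<in> {v \<in> N x. v \<in> repeated \<phi> x \<or> v \<in> U}"
        using w \<kappa>_eq[OF w(3)] by (auto simp: repeated_def)
    qed
    then have "card B1 \<le> card {v \<in> N x. v \<in> repeated \<phi> x \<or> v \<in> U}"
      using finite_N by (intro card_mono) auto
    then have B1: "card B1 < 2 * t" using cU[OF x] by linarith
    have B2: "card B2 \<le> 2 * t"
    proof (cases "x \<in> U")
      case False
      have "B2 \<subseteq> conflicts \<phi> x"
      proof
        fix y assume "y \<in> B2"
        then obtain w where w: "y \<in> N x" "w \<in> N y - {x}" "\<kappa> w = \<kappa> x" by (auto simp: B2_def)
        have "w \<in> V" using w N_subset by auto
        then show "y \<in> conflicts \<phi> x"
          using w \<kappa>_eq[OF w(3)] x False by (auto simp: conflicts_def)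
      qed
      then have "card B2 \<le> card (conflicts \<phi> x)"
        using finite_N by (intro card_mono) (auto simp: conflicts_def)
      moreover have "\<not> heavy \<phi> x" using False x by (simp add: U_def)
      ultimately show ?thesis by (simp add: heavy_def)
    next
      case True
      define W where "W = {w. w \<in> U - {x} \<and> \<psi> w = \<psi> x}"
      have finW: "finite W" using finU by (auto simp: W_def)
      have "B2 \<subseteq> (\<Union>w\<in>W. N x \<inter> N w)"
      proof
        fix y assume "y \<in> B2"
        then obtain w where w: "y \<in> N x" "w \<in> N y - {x}" "\<kappa> w = \<kappa> x" by (auto simp: B2_def)
        have "w \<in> V" using w N_subset by auto
        then have "w \<in> W" using w \<kappa>_eq[OF w(3)] x True by (auto simp: W_def)
        then show "y \<in> (\<Union>w\<in>W. N x \<inter> N w)" using w N_sym by blast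
      qed
      then have "card B2 \<le> card (\<Union>w\<in>W. N x \<inter> N w)"
        using finW finite_N by (intro card_mono) auto
      also have "\<dots> \<le> (\<Sum>w\<in>W. card (N x \<inter> N w))" using finW by (rule card_UN_le)
      finally have "n * card B2 \<le> n * (\<Sum>w\<in>W. card (N x \<inter> N w))" by simp
      also have "\<dots> \<le> (\<Sum>w\<in>U - {x}. card (N x \<inter> N w))"
        using \<psi>(2)[OF True] by (simp add: W_def)
      \<comment> \<open>Count walks \<open>x, u, w\<close> that end in \<open>U\<close>: at most
        \<open>16 * t \<le> n\<close> choices of \<open>u\<close>, each with fewer than
        \<open>2 * t\<close> neighbours in \<open>U\<close>.\<close>
      also have "\<dots> \<le> (\<Sum>w\<in>U. card {u \<in> N x. w \<in> N u})"
      proof -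
        have "N x \<inter> N w = {u \<in> N x. w \<in> N u}" for w using N_sym by blast
        then show ?thesis using finU by (simp add: sum_mono2)
      qed
      also have "\<dots> = (\<Sum>u\<in>N x. card {w \<in> U. w \<in> N u})"
        by (rule sum_multicount_gen) (use finU finite_N in auto)
      also have "\<dots> \<le> (\<Sum>u\<in>N x. 2 * t)"
      proof (rule sum_mono)
        fix u assume "u \<in> N x"
        then have "u \<in> V" using N_subset by auto
        have "card {w \<in> U. w \<in> N u} \<le> card {v \<in> N u. v \<in> repeated \<phi> u \<or> v \<in> U}"
          using finite_N by (intro card_mono) auto
        then show "card {w \<in> U. w \<in> N u} \<le> 2 * t" using cU[OF \<open>u \<in> V\<close>] by linarith
      qed
      also have "\<dots> \<le> n * (2 * t)"
        using N_card[of x] n0 by simp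
      finally show ?thesis using n0 by simp
    qed
    have "{y \<in> N x. (\<exists>w\<in>N x - {y}. \<kappa> w = \<kappa> y) \<or> (\<exists>w\<in>N y - {x}. \<kappa> w = \<kappa> x)} = B1 \<union> B2"
      by (auto simp: B1_def B2_def)
    then show ?thesis using card_Un_le[of B1 B2] B1 B2 by simp
  qed
  moreover have "\<kappa> v < 2 * n" if "v \<in> V" for v
    using \<phi>n[OF that] \<psi>(1)[of v] by (simp add: \<kappa>_def)
  ultimately show ?thesis by blast
qed

end

section \<open>Edge colourings without monochromatic cycles\<close>

text \<open>Greedy colouring: an edge meets fewer than \<open>2 * D\<close> others. This is the base
  of the recursion on \<open>D\<close>.\<close>

lemma proper_edge_colouring:
  assumes "finite E" "\<And>e. e \<in> E \<Longrightarrow> card e = 2" "\<And>v. card {e \<in> E. v \<in> e} \<le> D"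
  shows "\<exists>f. f ` E \<subseteq> {..<2 * D} \<and> (\<forall>e\<in>E. \<forall>e'\<in>E. e \<noteq> e' \<and> e \<inter> e' \<noteq> {} \<longrightarrow> f e \<noteq> (f e' :: nat))"
  using assms
proof (induction E)
  case (insert e E)
  have deg: "card {e' \<in> E. v \<in> e'} \<le> D" for v
    using insert.prems(2)[of v] card_mono[of "{e' \<in> insert e E. v \<in> e'}" "{e' \<in> E. v \<in> e'}"] insert.hyps
    by (fastforce intro: le_trans)
  have "\<exists>f. f ` E \<subseteq> {..<2 * D} \<and> (\<forall>e\<in>E. \<forall>e'\<in>E. e \<noteq> e' \<and> e \<inter> e' \<noteq> {} \<longrightarrow> f e \<noteq> (f e' :: nat))"
    by (rule insert.IH) (use insert.prems(1) deg in auto)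
  then obtain f where "f ` E \<subseteq> {..<2 * D} \<and>
    (\<forall>e\<in>E. \<forall>e'\<in>E. e \<noteq> e' \<and> e \<inter> e' \<noteq> {} \<longrightarrow> f e \<noteq> (f e' :: nat))" ..
  then have f: "f ` E \<subseteq> {..<2 * D}"
    "e \<in> E \<Longrightarrow> e' \<in> E \<Longrightarrow> e \<noteq> e' \<Longrightarrow> e \<inter> e' \<noteq> {} \<Longrightarrow> f e \<noteq> f e'" for e e'
    by simp_all
  obtain a b where e: "e = {a, b}" using insert.prems(1)[of e] by (auto simp: card_2_iff)
  have lt: "card {e' \<in> E. v \<in> e'} < D" if "v \<in> e" for v
  proof -
    have "{e' \<in> insert e E. v \<in> e'} = insert e {e' \<in> E. v \<in> e'}" using that by auto
    then show ?thesis using insert.prems(2)[of v] insert.hyps by simp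
  qed
  define F where "F = f ` {e' \<in> E. e' \<inter> e \<noteq> {}}"
  have "card F \<le> card {e' \<in> E. e' \<inter> e \<noteq> {}}" unfolding F_def using insert.hyps by (intro card_image_le) auto
  also have "{e' \<in> E. e' \<inter> e \<noteq> {}} = {e' \<in> E. a \<in> e'} \<union> {e' \<in> E. b \<in> e'}" using e by auto
  also have "card \<dots> \<le> card {e' \<in> E. a \<in> e'} + card {e' \<in> E. b \<in> e'}" by (rule card_Un_le)
  also have "\<dots> < 2 * D" using lt[of a] lt[of b] e by simp
  finally have "card F < card {..<2 * D}" by simp
  then have "\<not> {..<2 * D} \<subseteq> F" using insert.hyps card_mono[of F "{..<2 * D}"] by (auto simp: F_def)
  then obtain c where c: "c < 2 * D" "c \<notin> F" by auto
  show ?case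
  proof (intro exI[of _ "f(e := c)"] conjI ballI impI)
    show "(f(e := c)) ` insert e E \<subseteq> {..<2 * D}" using f(1) c by auto
    fix x y assume "x \<in> insert e E" "y \<in> insert e E" "x \<noteq> y \<and> x \<inter> y \<noteq> {}"
    then show "(f(e := c)) x \<noteq> (f(e := c)) y"
      using f(2)[of x y] c(2) unfolding F_def by (auto simp: Int_commute)
  qed
qed simp

text \<open>At each vertex at most \<open>D / 2\<close> edges fail to cross the cut and at most
  \<open>4 * t \<le> (D + 15) / 4\<close> fail to be star-injective; together these give the bound
  on \<open>E'\<close>. The palette has \<open>2 * n \<le> 2 ^ 39 * 144 * D\<close> colours.\<close>

lemma peel_cycle_free_edges:
  fixes E :: "'a :: linorder set set"
  assumes k: "k = 3 \<or> k = 5" and D: "1 \<le> D"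
    and E: "finite E" "\<And>e. e \<in> E \<Longrightarrow> card e = 2" "\<And>v. card {e \<in> E. v \<in> e} \<le> D"
  shows "\<exists>E' f s. E' \<subseteq> E \<and> (\<forall>v. 4 * card {e \<in> E'. v \<in> e} \<le> 3 * D + 15) \<and>
    (\<forall>e\<in>E - E'. f e < s) \<and> real s \<le> 2 ^ k * (2 ^ 39 * 144 * real D) powr (1 - 1 / real k) \<and>
    (\<forall>c. \<not> has_cycle (\<lambda>u v. {u, v} \<in> E - E' \<and> f {u, v} = (c :: nat)) (2 * k))"
proof -
  define V where "V = \<Union> E"
  define N where "N v = {u. {u, v} \<in> E}" for v
  define t where "t = (D + 15) div 16"
  have t: "D \<le> 16 * t" "16 * t \<le> D + 15" "1 \<le> t" "t \<le> D" using D by (auto simp: t_def)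
  have "finite e" if "e \<in> E" for e using E(2)[OF that] by (auto intro: card_ge_0_finite)
  then have finV: "finite V" unfolding V_def using E(1) by blast
  have NV: "N v \<subseteq> V" for v by (auto simp: N_def V_def)
  have irrefl: "{v, v} \<notin> E" for v using E(2)[of "{v, v}"] by auto
  have Ncard: "card (N v) \<le> D" for v
  proof -
    have "inj_on (\<lambda>u. {u, v}) (N v)" using irrefl by (auto simp: inj_on_def doubleton_eq_iff)
    then have "card (N v) \<le> card {e \<in> E. v \<in> e}"
      by (rule card_inj_on_le) (use E in \<open>auto simp: N_def\<close>)
    then show ?thesis using E(3)[of v] by simp
  qed
  interpret bounded_degree_graph V N t
  proof
    show "card (N v) \<le> 16 * t" for v using Ncard[of v] t(1) by linarith
  qed (use finV NV t in \<open>auto simp: N_def insert_commute\<close>)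
  define n where "n = 2 ^ 38 * (144 * t)"
  obtain \<kappa> where \<kappa>: "\<And>v. v \<in> V \<Longrightarrow> \<kappa> v < 2 * n"
    "\<And>x. x \<in> V \<Longrightarrow> card {y \<in> N x. (\<exists>w\<in>N x - {y}. \<kappa> w = \<kappa> y) \<or> (\<exists>w\<in>N y - {x}. \<kappa> w = \<kappa> x)} \<le> 4 * t"
    using exists_star_injective_colouring[OF n_def] by blast
  \<comment> \<open>A locally maximal cut: at least half of the edges at every vertex cross it. The
    cut decides which end of an edge goes to which side of the complete bipartite target.\<close>
  have "\<exists>\<sigma> :: 'a \<Rightarrow> nat. (\<forall>v\<in>V. \<sigma> v < 2) \<and> (\<forall>v\<in>V. 2 * (\<Sum>w | w \<in> V - {v} \<and> \<sigma> w = \<sigma> v. if {v, w} \<in> E then 1 else 0)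
      \<le> (\<Sum>w\<in>V - {v}. if {v, w} \<in> E then 1 else 0 :: nat))"
    by (rule local_minimum_colouring) (use finV in \<open>auto simp: insert_commute\<close>)
  then obtain \<sigma> :: "'a \<Rightarrow> nat" where \<sigma>: "\<And>v. v \<in> V \<Longrightarrow> \<sigma> v < 2"
    "\<And>v. v \<in> V \<Longrightarrow> 2 * (\<Sum>w | w \<in> V - {v} \<and> \<sigma> w = \<sigma> v. if {v, w} \<in> E then 1 else 0)
      \<le> (\<Sum>w\<in>V - {v}. if {v, w} \<in> E then 1 else 0 :: nat)" by blast
  have same: "2 * card {u \<in> N v. \<sigma> u = \<sigma> v} \<le> D" if "v \<in> V" for v
  proof -
    have "(\<Sum>w | w \<in> V - {v} \<and> \<sigma> w = \<sigma> v. if {v, w} \<in> E then 1 else 0) =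
      card {w \<in> {w. w \<in> V - {v} \<and> \<sigma> w = \<sigma> v}. {v, w} \<in> E}"
      using finV by (simp add: sum.inter_filter[symmetric])
    also have "{w \<in> {w. w \<in> V - {v} \<and> \<sigma> w = \<sigma> v}. {v, w} \<in> E} = {u \<in> N v. \<sigma> u = \<sigma> v}"
      using irrefl by (auto simp: N_def V_def insert_commute)
    finally have 1: "(\<Sum>w | w \<in> V - {v} \<and> \<sigma> w = \<sigma> v. if {v, w} \<in> E then 1 else 0) = card {u \<in> N v. \<sigma> u = \<sigma> v}" .
    have "(\<Sum>w\<in>V - {v}. if {v, w} \<in> E then 1 else 0) = card {w \<in> V - {v}. {v, w} \<in> E}"
      using finV by (simp add: sum.inter_filter[symmetric])
    also have "\<dots> \<le> card (N v)"
      by (rule card_mono[OF finite_N]) (auto simp: N_def insert_commute)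
    also have "\<dots> \<le> D" by (rule Ncard)
    finally show ?thesis using \<sigma>(2)[OF that] unfolding 1 by linarith
  qed
  define bad2 where "bad2 x y \<longleftrightarrow> \<sigma> x = \<sigma> y \<or> (\<exists>w\<in>N x - {y}. \<kappa> w = \<kappa> y) \<or> (\<exists>w\<in>N y - {x}. \<kappa> w = \<kappa> x)" for x y
  have bad2_sym: "bad2 x y \<longleftrightarrow> bad2 y x" for x y by (auto simp: bad2_def)
  define E' where "E' = {e \<in> E. \<exists>x y. e = {x, y} \<and> bad2 x y}"
  have E': "{x, y} \<in> E' \<longleftrightarrow> {x, y} \<in> E \<and> bad2 x y" for x y
    using bad2_sym by (auto simp: E'_def doubleton_eq_iff)
  have "4 * card {e \<in> E'. v \<in> e} \<le> 3 * D + 15" for v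
  proof (cases "v \<in> V")
    case False
    then have empty: "{e \<in> E'. v \<in> e} = {}" by (auto simp: V_def E'_def)
    show ?thesis unfolding empty by simp
  next
    case True
    have "{e \<in> E'. v \<in> e} \<subseteq> (\<lambda>u. {u, v}) ` {u \<in> N v. bad2 v u}"
    proof
      fix e assume e: "e \<in> {e \<in> E'. v \<in> e}"
      then have "e \<in> E" by (simp add: E'_def)
      then obtain a b where ab: "e = {a, b}" using E(2)[of e] by (auto simp: card_2_iff)
      then have "e = {a, v} \<or> e = {b, v}" using e by auto
      then obtain u where u: "e = {u, v}" by auto
      then have "bad2 v u" "u \<in> N v" using e E'[of u v] bad2_sym by (auto simp: N_def)
      then show "e \<in> (\<lambda>u. {u, v}) ` {u \<in> N v. bad2 v u}" using u by auto
    qed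
    then have "card {e \<in> E'. v \<in> e} \<le> card {u \<in> N v. bad2 v u}"
      by (rule surj_card_le[rotated]) (use finite_N in auto)
    also have "{u \<in> N v. bad2 v u} = {u \<in> N v. \<sigma> u = \<sigma> v} \<union>
      {y \<in> N v. (\<exists>w\<in>N v - {y}. \<kappa> w = \<kappa> y) \<or> (\<exists>w\<in>N y - {v}. \<kappa> w = \<kappa> v)}"
      by (auto simp: bad2_def)
    also have "card \<dots> \<le> card {u \<in> N v. \<sigma> u = \<sigma> v} +
      card {y \<in> N v. (\<exists>w\<in>N v - {y}. \<kappa> w = \<kappa> y) \<or> (\<exists>w\<in>N y - {v}. \<kappa> w = \<kappa> v)}" by (rule card_Un_le)
    finally have "card {e \<in> E'. v \<in> e} \<le> card {u \<in> N v. \<sigma> u = \<sigma> v} + 4 * t"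
      using \<kappa>(2)[OF True] by linarith
    then show ?thesis using same[OF True] t by linarith
  qed
  moreover
  have n1: "1 \<le> 2 * n" using t by (simp add: n_def)
  define closed_walk where "closed_walk \<chi> p l c \<longleftrightarrow> (\<forall>i<k. p i < 2 * n \<and> l i < 2 * n \<and>
      p i \<noteq> p (Suc i mod k) \<and> l i \<noteq> l (Suc i mod k) \<and>
      \<chi> (p i) (l i) = c \<and> \<chi> (p (Suc i mod k)) (l i) = c)"
    for \<chi> :: "nat \<Rightarrow> nat \<Rightarrow> nat" and p l c
  have "\<exists>\<chi> s. (\<forall>i<2 * n. \<forall>j<2 * n. \<chi> i j < s) \<and>
      real s \<le> 2 ^ k * real (2 * n) powr (1 - 1 / real k) \<and> (\<forall>p l c. \<not> closed_walk \<chi> p l c)"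
    using wenger_colouring[OF k n1] unfolding closed_walk_def not_all not_imp .
  then obtain \<chi> s where \<chi>: "\<And>i j. i < 2 * n \<Longrightarrow> j < 2 * n \<Longrightarrow> \<chi> i j < s"
    and s: "real s \<le> 2 ^ k * real (2 * n) powr (1 - 1 / real k)"
    and walk: "\<And>p l c. \<not> closed_walk \<chi> p l c"
    by blast
  \<comment> \<open>The end with \<open>\<sigma>\<close> equal to 0 plays the point and the other
    end the line. This is meaningful outside \<open>E'\<close>, where the ends lie on different
    sides.\<close>
  define f where "f e = \<chi> (\<kappa> (THE x. x \<in> e \<and> \<sigma> x = 0)) (\<kappa> (THE x. x \<in> e \<and> \<sigma> x \<noteq> 0))" for e
  have f: "f {x, y} = \<chi> (\<kappa> x) (\<kappa> y)" if "\<sigma> x = 0" "\<sigma> y \<noteq> 0" for x y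
  proof -
    have "(THE z. z \<in> {x, y} \<and> \<sigma> z = 0) = x" using that by (intro the_equality) auto
    moreover have "(THE z. z \<in> {x, y} \<and> \<sigma> z \<noteq> 0) = y" using that by (intro the_equality) auto
    ultimately show ?thesis by (simp add: f_def)
  qed
  have "f e < s" if e: "e \<in> E - E'" for e
  proof -
    obtain a b where ab: "e = {a, b}" using E(2)[of e] e by (auto simp: card_2_iff)
    then have "\<sigma> a \<noteq> \<sigma> b" using e E'[of a b] by (auto simp: bad2_def)
    moreover have V: "a \<in> V" "b \<in> V" using e ab by (auto simp: V_def)
    ultimately have "\<sigma> a = 0 \<and> \<sigma> b \<noteq> 0 \<or> \<sigma> b = 0 \<and> \<sigma> a \<noteq> 0" using \<sigma>(1)[of a] \<sigma>(1)[of b] by linarith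
    then show ?thesis
      using f[of a b] f[of b a] \<chi> \<kappa>(1) V by (auto simp: ab insert_commute)
  qed
  moreover have "real s \<le> 2 ^ k * (2 ^ 39 * 144 * real D) powr (1 - 1 / real k)"
  proof -
    have "real (2 * n) \<le> 2 ^ 39 * 144 * real D" using t by (simp add: n_def)
    then have "real (2 * n) powr (1 - 1 / real k) \<le> (2 ^ 39 * 144 * real D) powr (1 - 1 / real k)"
      using k by (intro powr_mono2) auto
    then show ?thesis using s by (meson mult_left_mono order_trans zero_le_numeral zero_le_power)
  qed
  moreover have "\<not> has_cycle (\<lambda>u v. {u, v} \<in> E - E' \<and> f {u, v} = c) (2 * k)" for c
  proof
    assume "has_cycle (\<lambda>u v. {u, v} \<in> E - E' \<and> f {u, v} = c) (2 * k)"
    then obtain v where v: "inj_on v {..<2 * k}"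
      "\<And>i. i < 2 * k \<Longrightarrow> {v i, v (Suc i mod (2 * k))} \<in> E - E' \<and> f {v i, v (Suc i mod (2 * k))} = c"
      unfolding has_cycle_def by blast
    have k0: "0 < k" "1 < k" using k by auto
    have good: "\<sigma> x \<noteq> \<sigma> y \<and> x \<in> V \<and> y \<in> V \<and> y \<in> N x" if "{x, y} \<in> E - E'" for x y
      using that E'[of x y] by (auto simp: bad2_def V_def N_def insert_commute)
    have flip: "\<sigma> x = 0 \<longleftrightarrow> \<sigma> y \<noteq> 0" if "{x, y} \<in> E - E'" for x y
      using good[OF that] \<sigma>(1)[of x] \<sigma>(1)[of y] by auto
    \<comment> \<open>Rotate the cycle so that it starts on the point side; even positions then are
      points and odd ones lines.\<close>
    define r :: nat where "r = (if \<sigma> (v 0) = 0 then 0 else 1)"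
    define w where "w i = v ((i + r) mod (2 * k))" for i
    have w0: "\<sigma> (w 0) = 0" using flip[of "v 0" "v 1"] v(2)[of 0] k0 by (auto simp: w_def r_def)
    have wE: "{w i, w (Suc i)} \<in> E - E'" "f {w i, w (Suc i)} = c" for i
      using v(2)[of "(i + r) mod (2 * k)"] k0 by (auto simp: w_def mod_Suc_eq)
    have w_mod: "w (i mod (2 * k)) = w i" for i by (simp add: w_def mod_add_left_eq)
    have w_inj: "w i \<noteq> w j" if "i < 2 * k" "j < 2 * k" "i \<noteq> j" for i j
    proof
      assume "w i = w j"
      then have "(i + r) mod (2 * k) = (j + r) mod (2 * k)"
        using v(1) k0 by (auto simp: w_def inj_on_def)
      then have "i = j" using that(1,2) by (auto simp: r_def mod_Suc split: if_splits)
      then show False using that(3) by simp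
    qed
    have par: "\<sigma> (w i) = 0 \<longleftrightarrow> even i" for i
    proof (induction i)
      case 0
      then show ?case using w0 by simp
    next
      case (Suc i)
      then show ?case using flip[OF wE(1)[of i]] by auto
    qed
    have wV: "w i \<in> V" for i using good[OF wE(1)[of i]] by simp
    define p where "p i = \<kappa> (w (2 * i))" for i
    define l where "l i = \<kappa> (w (2 * i + 1))" for i
    \<comment> \<open>Star-injectivity becomes non-backtracking: \<open>w i\<close> and
      \<open>w (i + 2)\<close> are neighbours of \<open>w (i + 1)\<close>, and the colour of
      \<open>w i\<close> is unique among those.\<close>
    have nb: "\<kappa> (w i) \<noteq> \<kappa> (w (i + 2))" if "w i \<noteq> w (i + 2)" for i
    proof -
      have "\<not> bad2 (w (Suc i)) (w i)" using wE(1)[of i] E'[of "w i" "w (Suc i)"] bad2_sym by blast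
      moreover have "w (i + 2) \<in> N (w (Suc i))" using good[OF wE(1)[of "Suc i"]] by simp
      ultimately show ?thesis using that unfolding bad2_def by fastforce
    qed
    have step: "2 * (Suc i mod k) = (2 * i + 2) mod (2 * k)" for i
      by (simp add: mult_mod_right)
    have ne: "w i \<noteq> w (i + 2)" for i
    proof -
      have "i mod (2 * k) \<noteq> (i + 2) mod (2 * k)"
      proof
        assume "i mod (2 * k) = (i + 2) mod (2 * k)"
        then have "2 * k dvd i + 2 - i" using mod_eq_dvd_iff_nat[of i "i + 2" "2 * k"] by simp
        then have "2 * k \<le> 2" by (auto dest: dvd_imp_le)
        then show False using k0 by simp
      qed
      then have "w (i mod (2 * k)) \<noteq> w ((i + 2) mod (2 * k))"
        using k0 by (intro w_inj) auto
      then show ?thesis by (simp only: w_mod not_False_eq_True)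
    qed
    have pS: "p (Suc i mod k) = \<kappa> (w (2 * i + 2))" for i unfolding p_def step w_mod ..
    have lS: "l (Suc i mod k) = \<kappa> (w (2 * i + 3))" for i
    proof -
      have "w (2 * (Suc i mod k) + 1) = w (((2 * i + 2) mod (2 * k) + 1) mod (2 * k))"
        unfolding step w_mod ..
      also have "((2 * i + 2) mod (2 * k) + 1) mod (2 * k) = (2 * i + 3) mod (2 * k)"
        by (simp add: mod_Suc_eq numeral_3_eq_3)
      finally show ?thesis by (simp add: l_def w_mod)
    qed
    have "p i < 2 * n \<and> l i < 2 * n \<and> p i \<noteq> p (Suc i mod k) \<and> l i \<noteq> l (Suc i mod k) \<and>
       \<chi> (p i) (l i) = c \<and> \<chi> (p (Suc i mod k)) (l i) = c" for i
    proof (intro conjI)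
      show "p i < 2 * n" "l i < 2 * n" using \<kappa>(1) wV by (auto simp: p_def l_def)
      show "p i \<noteq> p (Suc i mod k)" unfolding pS p_def[of i] by (rule nb[OF ne])
      show "l i \<noteq> l (Suc i mod k)" unfolding lS l_def[of i] using nb[OF ne, of "2 * i + 1"] by (simp add: numeral_3_eq_3)
      show "\<chi> (p i) (l i) = c"
        using f[of "w (2 * i)" "w (2 * i + 1)"] wE(2)[of "2 * i"] par by (simp add: p_def l_def)
      show "\<chi> (p (Suc i mod k)) (l i) = c"
        unfolding pS using f[of "w (2 * i + 2)" "w (2 * i + 1)"] wE(2)[of "2 * i + 1"] par
        by (simp add: l_def insert_commute)
    qed
    then have "closed_walk \<chi> p l c" unfolding closed_walk_def by blast
    then show False using walk by blast
  qed
  moreover have "E' \<subseteq> E" by (auto simp: E'_def)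
  ultimately show ?thesis by blast
qed

text \<open>Stated for bare edge sets, with \<open>K\<close> independent of \<open>D\<close> and
  \<open>E\<close>, so that the induction on \<open>D\<close> can pass to the edges left
  over.\<close>

lemma cycle_free_edge_colouring:
  assumes k: "k = 3 \<or> k = 5"
  shows "\<exists>K>0. \<forall>D (E :: 'a :: linorder set set). finite E \<longrightarrow> (\<forall>e\<in>E. card e = 2) \<longrightarrow>
    (\<forall>v. card {e \<in> E. v \<in> e} \<le> D) \<longrightarrow>
    (\<exists>f s. f ` E \<subseteq> {..<s} \<and> real s \<le> K * real D powr (1 - 1 / real k) \<and>
      (\<forall>c. \<not> has_cycle (\<lambda>u v. {u, v} \<in> E \<and> f {u, v} = (c :: nat)) (2 * k)))"
proof -
  define \<alpha> where "\<alpha> = 1 - 1 / real k"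
  have \<alpha>: "0 < \<alpha>" using k by (auto simp: \<alpha>_def)
  define K1 :: real where "K1 = 2 ^ k * (2 ^ 39 * 144) powr \<alpha>"
  define \<rho> :: real where "\<rho> = (7 / 8) powr \<alpha>"
  have \<rho>: "\<rho> < 1" unfolding \<rho>_def using powr_less_mono2[OF \<alpha>, of "7 / 8" 1] by simp
  \<comment> \<open>\<open>K\<close> closes the geometric recursion: a round costs at most
    \<open>K1 * D powr \<alpha>\<close>, and passing to degree \<open>7 / 8 * D\<close> contributes
    the factor \<open>\<rho>\<close>. The 64 pays for the base case, which uses
    \<open>2 * D < 64\<close> colours.\<close>
  define K where "K = max 64 (K1 / (1 - \<rho>))"
  have K: "64 \<le> K" "K1 + K * \<rho> \<le> K"
  proof -
    show "64 \<le> K" by (simp add: K_def)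
    have "K1 / (1 - \<rho>) \<le> K" by (simp add: K_def)
    then show "K1 + K * \<rho> \<le> K" using \<rho> by (simp add: field_simps)
  qed
  have "\<exists>f s. f ` E \<subseteq> {..<s} \<and> real s \<le> K * real D powr \<alpha> \<and>
      (\<forall>c. \<not> has_cycle (\<lambda>u v. {u, v} \<in> E \<and> f {u, v} = (c :: nat)) (2 * k))"
    if "finite E" "\<And>e. e \<in> E \<Longrightarrow> card e = 2" "\<And>v. card {e \<in> E. v \<in> e} \<le> D"
    for D and E :: "'a set set"
    using that
  proof (induction D arbitrary: E rule: less_induct)
    case (less D)
    show ?case
    \<comment> \<open>From 32 on, \<open>(3 * D + 15) / 4\<close> is at most
      \<open>7 / 8 * D\<close>; for small \<open>D\<close> the summand 15 can stop the
      descent.\<close>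
    proof (cases "D < 32")
      case True
      from proper_edge_colouring[OF less.prems] obtain f where
        "f ` E \<subseteq> {..<2 * D} \<and> (\<forall>e\<in>E. \<forall>e'\<in>E. e \<noteq> e' \<and> e \<inter> e' \<noteq> {} \<longrightarrow> f e \<noteq> (f e' :: nat))" ..
      then have f: "f ` E \<subseteq> {..<2 * D}"
        "e \<in> E \<Longrightarrow> e' \<in> E \<Longrightarrow> e \<noteq> e' \<Longrightarrow> e \<inter> e' \<noteq> {} \<Longrightarrow> f e \<noteq> f e'" for e e'
        by simp_all
      have "\<not> has_cycle (\<lambda>u v. {u, v} \<in> E \<and> f {u, v} = c) (2 * k)" for c
      proof
        assume "has_cycle (\<lambda>u v. {u, v} \<in> E \<and> f {u, v} = c) (2 * k)"
        then obtain v where v: "inj_on v {..<2 * k}"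
          "\<And>i. i < 2 * k \<Longrightarrow> {v i, v (Suc i mod (2 * k))} \<in> E \<and> f {v i, v (Suc i mod (2 * k))} = c"
          unfolding has_cycle_def by blast
        have less: "0 < 2 * k" "1 < 2 * k" "2 < 2 * k" using k by auto
        then have "v 0 \<noteq> v 2" "v 0 \<noteq> v 1"
          using inj_onD[OF v(1), of 0 2] inj_onD[OF v(1), of 0 1] by auto
        then have ne: "{v 0, v 1} \<noteq> {v 1, v 2}" by (auto simp: doubleton_eq_iff)
        have "Suc 0 mod (2 * k) = 1" "Suc 1 mod (2 * k) = 2" using k by auto
        then have e: "{v 0, v 1} \<in> E" "f {v 0, v 1} = c" "{v 1, v 2} \<in> E" "f {v 1, v 2} = c"
          using v(2)[OF less(1)] v(2)[OF less(2)] by auto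
        have "f {v 0, v 1} \<noteq> f {v 1, v 2}" by (rule f(2)[OF e(1,3) ne]) auto
        then show False using e by simp
      qed
      moreover have "real (2 * D) \<le> K * real D powr \<alpha>"
      proof (cases "D = 0")
        case False
        then have "1 \<le> real D powr \<alpha>" using \<alpha> by (intro ge_one_powr_ge_zero) auto
        then have "64 * 1 \<le> K * real D powr \<alpha>" using K by (intro mult_mono) auto
        then show ?thesis using True by simp
      qed simp
      ultimately show ?thesis using f(1) by blast
    next
      case False
      then have "1 \<le> D" by simp
      have "\<exists>E' f s. E' \<subseteq> E \<and> (\<forall>v. 4 * card {e \<in> E'. v \<in> e} \<le> 3 * D + 15) \<and>
        (\<forall>e\<in>E - E'. f e < s) \<and> real s \<le> 2 ^ k * (2 ^ 39 * 144 * real D) powr (1 - 1 / real k) \<and>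
        (\<forall>c. \<not> has_cycle (\<lambda>u v. {u, v} \<in> E - E' \<and> f {u, v} = (c :: nat)) (2 * k))"
        by (rule peel_cycle_free_edges[OF k \<open>1 \<le> D\<close>]) (use less.prems in auto)
      then obtain E' f s where *: "E' \<subseteq> E \<and> (\<forall>v. 4 * card {e \<in> E'. v \<in> e} \<le> 3 * D + 15) \<and>
        (\<forall>e\<in>E - E'. f e < s) \<and> real s \<le> 2 ^ k * (2 ^ 39 * 144 * real D) powr (1 - 1 / real k) \<and>
        (\<forall>c. \<not> has_cycle (\<lambda>u v. {u, v} \<in> E - E' \<and> f {u, v} = (c :: nat)) (2 * k))"
        by (elim exE)
      have E': "E' \<subseteq> E" "4 * card {e \<in> E'. v \<in> e} \<le> 3 * D + 15" for v
        using * by blast+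
      have f: "e \<in> E - E' \<Longrightarrow> f e < s" "real s \<le> 2 ^ k * (2 ^ 39 * 144 * real D) powr \<alpha>"
        "\<not> has_cycle (\<lambda>u v. {u, v} \<in> E - E' \<and> f {u, v} = c) (2 * k)" for e c
        using * unfolding \<alpha>_def by blast+
      define D' where "D' = 7 * D div 8"
      have "D' < D" using False by (simp add: D'_def)
      moreover have "card {e \<in> E'. v \<in> e} \<le> D'" for v
        using E'(2)[of v] False unfolding D'_def by linarith
      moreover have "finite E'" using E'(1) less.prems(1) finite_subset by blast
      moreover have "card e = 2" if "e \<in> E'" for e using less.prems(2) E'(1) that by blast
      ultimately have "\<exists>f s. f ` E' \<subseteq> {..<s} \<and> real s \<le> K * real D' powr \<alpha> \<and>
        (\<forall>c. \<not> has_cycle (\<lambda>u v. {u, v} \<in> E' \<and> f {u, v} = (c :: nat)) (2 * k))"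
        by (intro less.IH)
      then obtain f' s' where **: "f' ` E' \<subseteq> {..<s'} \<and> real s' \<le> K * real D' powr \<alpha> \<and>
        (\<forall>c. \<not> has_cycle (\<lambda>u v. {u, v} \<in> E' \<and> f' {u, v} = (c :: nat)) (2 * k))"
        by (elim exE)
      have f': "f' ` E' \<subseteq> {..<s'}" "real s' \<le> K * real D' powr \<alpha>"
        "\<not> has_cycle (\<lambda>u v. {u, v} \<in> E' \<and> f' {u, v} = c) (2 * k)" for c
        using ** by blast+
      define g where "g e = (if e \<in> E' then s + f' e else f e)" for e
      have "g ` E \<subseteq> {..<s + s'}" using f(1) f'(1) by (fastforce simp: g_def)
      moreover have "real (s + s') \<le> K * real D powr \<alpha>"
      proof -
        have "real D' \<le> 7 / 8 * real D" unfolding D'_def by linarith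
        then have "real D' powr \<alpha> \<le> (7 / 8 * real D) powr \<alpha>" using \<alpha> by (intro powr_mono2) auto
        also have "\<dots> = \<rho> * real D powr \<alpha>" by (simp only: \<rho>_def powr_mult)
        finally have "K * real D' powr \<alpha> \<le> K * (\<rho> * real D powr \<alpha>)" using K by (intro mult_left_mono) auto
        then have "real s' \<le> K * \<rho> * real D powr \<alpha>" using f'(2) by (simp add: mult.assoc)
        moreover have "real s \<le> K1 * real D powr \<alpha>"
          using f(2) unfolding K1_def powr_mult by (simp add: mult.assoc)
        ultimately have "real (s + s') \<le> (K1 + K * \<rho>) * real D powr \<alpha>" by (simp add: distrib_right)
        also have "\<dots> \<le> K * real D powr \<alpha>" using K by (intro mult_right_mono) auto
        finally show ?thesis .
      qed
      moreover have "\<not> has_cycle (\<lambda>u v. {u, v} \<in> E \<and> g {u, v} = c) (2 * k)" for c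
      proof (cases "c < s")
        case True
        show ?thesis
        proof
          assume "has_cycle (\<lambda>u v. {u, v} \<in> E \<and> g {u, v} = c) (2 * k)"
          then have "has_cycle (\<lambda>u v. {u, v} \<in> E - E' \<and> f {u, v} = c) (2 * k)"
            by (rule has_cycle_mono) (use True in \<open>auto simp: g_def split: if_splits\<close>)
          then show False using f(3) by simp
        qed
      next
        case False
        show ?thesis
        proof
          assume "has_cycle (\<lambda>u v. {u, v} \<in> E \<and> g {u, v} = c) (2 * k)"
          then have "has_cycle (\<lambda>u v. {u, v} \<in> E' \<and> f' {u, v} = c - s) (2 * k)"
          proof (rule has_cycle_mono)
            show "{u, v} \<in> E' \<and> f' {u, v} = c - s" if "{u, v} \<in> E \<and> g {u, v} = c" for u v
              using that f(1)[of "{u, v}"] False by (auto simp: g_def split: if_splits)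
          qed
          then show False using f'(3) by simp
        qed
      qed
      ultimately show ?thesis by blast
    qed
  qed
  then show ?thesis using K(1) unfolding \<alpha>_def by (intro exI[of _ K]) auto
qed

text \<open>A cycle-free colouring of \<open>H\<close> with at most \<open>s\<close> colours would
  refute \<open>arrows\<close>, so \<open>s\<close> is below \<open>K * D powr \<alpha>\<close>,
  with \<open>D\<close> the maximum degree. Inverting the exponent \<open>\<alpha>\<close>, which is
  \<open>(k - 1) / k\<close>, gives the bound.\<close>

lemma degree_ramsey_even_cycle_lower:
  assumes k: "k = 3 \<or> k = 5"
  shows "\<exists>c>0. \<forall>s. \<forall>H :: nat sgraph. simple_graph H \<and> arrows H s (cycle_graph (2 * k)) \<longrightarrow>
    c * real s powr (real k / (real k - 1)) \<le> real (max_degree H)"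
proof -
  define \<alpha> where "\<alpha> = 1 - 1 / real k"
  have \<alpha>: "0 < \<alpha>" "real k / (real k - 1) = 1 / \<alpha>" using k by (auto simp: \<alpha>_def field_simps)
  from cycle_free_edge_colouring[OF k, where 'a = nat] obtain K where K: "K > 0"
    and colouring: "\<forall>D (E :: nat set set). finite E \<longrightarrow> (\<forall>e\<in>E. card e = 2) \<longrightarrow>
      (\<forall>v. card {e \<in> E. v \<in> e} \<le> D) \<longrightarrow>
      (\<exists>f s. f ` E \<subseteq> {..<s} \<and> real s \<le> K * real D powr \<alpha> \<and>
        (\<forall>c. \<not> has_cycle (\<lambda>u v. {u, v} \<in> E \<and> f {u, v} = (c :: nat)) (2 * k)))"
    unfolding \<alpha>_def by (elim exE conjE)
  have "(1 / K) powr (1 / \<alpha>) * real s powr (1 / \<alpha>) \<le> real (max_degree H)"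
    if H: "simple_graph H" "arrows H s (cycle_graph (2 * k))" for s and H :: "nat sgraph"
  proof -
    have m3: "3 \<le> 2 * k" using k by auto
    have fin: "finite (vertices H)" "\<And>e. e \<in> edges H \<Longrightarrow> e \<subseteq> vertices H \<and> card e = 2"
      using H(1) by (auto simp: simple_graph_def)
    have finE: "finite (edges H)" by (rule finite_subset[of _ "Pow (vertices H)"]) (use fin in auto)
    have deg: "card {e \<in> edges H. v \<in> e} \<le> max_degree H" for v
    proof (cases "v \<in> vertices H")
      case True
      then have "Defs.degree H v \<le> max_degree H" unfolding max_degree_def using fin(1) by (intro Max_ge) auto
      then show ?thesis unfolding Defs.degree_def .
    next
      case False
      then have empty: "{e \<in> edges H. v \<in> e} = {}" using fin by blast
      show ?thesis unfolding empty by simp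
    qed
    have two: "\<forall>e\<in>edges H. card e = 2" and le: "\<forall>v. card {e \<in> edges H. v \<in> e} \<le> max_degree H"
      using fin(2) deg by auto
    have "\<exists>f s. f ` edges H \<subseteq> {..<s} \<and> real s \<le> K * real (max_degree H) powr \<alpha> \<and>
      (\<forall>c. \<not> has_cycle (\<lambda>u v. {u, v} \<in> edges H \<and> f {u, v} = (c :: nat)) (2 * k))"
      by (rule colouring[THEN spec, THEN spec, THEN mp, THEN mp, THEN mp, OF finE two le])
    then obtain f s' where *: "f ` edges H \<subseteq> {..<s'} \<and> real s' \<le> K * real (max_degree H) powr \<alpha> \<and>
      (\<forall>c. \<not> has_cycle (\<lambda>u v. {u, v} \<in> edges H \<and> f {u, v} = (c :: nat)) (2 * k))"
      by (elim exE)
    then have f: "f ` edges H \<subseteq> {..<s'}" "real s' \<le> K * real (max_degree H) powr \<alpha>"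
      "\<not> has_cycle (\<lambda>u v. {u, v} \<in> edges H \<and> f {u, v} = c) (2 * k)" for c
      by blast+
    have "\<not> s' \<le> s"
    proof
      assume "s' \<le> s"
      then have "f ` edges H \<subseteq> {..<s}" using f(1) by fastforce
      then show False using H f(3) unfolding arrows_cycle_iff[OF H(1) m3] by blast
    qed
    then have "1 / K * real s \<le> real (max_degree H) powr \<alpha>" using f(2) K by (simp add: field_simps)
    then have "(1 / K * real s) powr (1 / \<alpha>) \<le> (real (max_degree H) powr \<alpha>) powr (1 / \<alpha>)"
      using K \<alpha> by (intro powr_mono2) auto
    also have "\<dots> = real (max_degree H)" using \<alpha> by (simp add: powr_powr)
    finally show ?thesis unfolding powr_mult .
  qed
  moreover have "(1 / K) powr (1 / \<alpha>) > 0" using K by simp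
  ultimately show ?thesis unfolding \<alpha>(2) by blast
qed

text \<open>The host from the upper bound makes the set of degrees nonempty. Hence
  \<open>Inf\<close> is attained by some host, to which the lower bound applies, and is not the
  default 0.\<close>

lemma degree_ramsey_even_cycle_bounds:
  assumes k: "k = 3 \<or> k = 5"
  shows "\<exists>c C. c > 0 \<and> C > 0 \<and> (\<forall>s\<ge>1.
    c * real s powr (real k / (real k - 1)) \<le> real (degree_ramsey (cycle_graph (2 * k)) s) \<and>
    real (degree_ramsey (cycle_graph (2 * k)) s) \<le> C * real s powr (real k / (real k - 1)))"
proof -
  obtain c where c: "c > 0" "\<And>s H :: nat sgraph. simple_graph H \<Longrightarrow> arrows H s (cycle_graph (2 * k)) \<Longrightarrow>
    c * real s powr (real k / (real k - 1)) \<le> real (max_degree H)"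
    using degree_ramsey_even_cycle_lower[OF k] by metis
  obtain C where C: "C > 0" "\<And>s. s \<ge> 1 \<Longrightarrow> \<exists>H :: nat sgraph. simple_graph H \<and>
    arrows H s (cycle_graph (2 * k)) \<and> real (max_degree H) \<le> C * real s powr (real k / (real k - 1))"
    using degree_ramsey_even_cycle_upper[of k] k by auto
  have "c * real s powr (real k / (real k - 1)) \<le> real (degree_ramsey (cycle_graph (2 * k)) s) \<and>
    real (degree_ramsey (cycle_graph (2 * k)) s) \<le> C * real s powr (real k / (real k - 1))"
    if s: "s \<ge> 1" for s
  proof -
    let ?S = "{max_degree H | H :: nat sgraph. simple_graph H \<and> arrows H s (cycle_graph (2 * k))}"
    obtain H :: "nat sgraph" where H: "simple_graph H" "arrows H s (cycle_graph (2 * k))"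
      "real (max_degree H) \<le> C * real s powr (real k / (real k - 1))"
      using C(2)[OF s] by blast
    have "max_degree H \<in> ?S" using H by blast
    then have "Inf ?S \<in> ?S" by (intro Inf_nat_def1) blast
    moreover have "Inf ?S \<le> max_degree H" using \<open>max_degree H \<in> ?S\<close> by (simp add: cInf_lower)
    ultimately show ?thesis using c(2) H(3) unfolding degree_ramsey_def by force
  qed
  then show ?thesis using c(1) C(1) by blast
qed

theorem theorem1p1:
  shows "\<exists>c C :: real. \<exists>s0 :: nat. c > 0 \<and> C > 0 \<and>
    (\<forall>s\<ge>s0.
       c * real s powr (3 / 2) \<le> real (degree_ramsey (cycle_graph 6) s) \<and>
       real (degree_ramsey (cycle_graph 6) s) \<le> C * real s powr (3 / 2) \<and>
       c * real s powr (5 / 4) \<le> real (degree_ramsey (cycle_graph 10) s) \<and>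
       real (degree_ramsey (cycle_graph 10) s) \<le> C * real s powr (5 / 4))"
proof -
  obtain c1 C1 where 1: "c1 > 0" "C1 > 0" "\<And>s. s \<ge> 1 \<Longrightarrow>
    c1 * real s powr (3 / 2) \<le> real (degree_ramsey (cycle_graph 6) s) \<and>
    real (degree_ramsey (cycle_graph 6) s) \<le> C1 * real s powr (3 / 2)"
    using degree_ramsey_even_cycle_bounds[of 3] by auto
  obtain c2 C2 where 2: "c2 > 0" "C2 > 0" "\<And>s. s \<ge> 1 \<Longrightarrow>
    c2 * real s powr (5 / 4) \<le> real (degree_ramsey (cycle_graph 10) s) \<and>
    real (degree_ramsey (cycle_graph 10) s) \<le> C2 * real s powr (5 / 4)"
    using degree_ramsey_even_cycle_bounds[of 5] by auto
  have lo: "min c1 c2 * x \<le> y" if "c1 * x \<le> y \<or> c2 * x \<le> y" "0 \<le> x" for x y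
    using that by (meson min.cobounded1 min.cobounded2 mult_right_mono order_trans)
  have hi: "y \<le> max C1 C2 * x" if "y \<le> C1 * x \<or> y \<le> C2 * x" "0 \<le> x" for x y
    using that by (meson max.cobounded1 max.cobounded2 mult_right_mono order_trans)
  show ?thesis
  proof (rule exI[of _ "min c1 c2"], rule exI[of _ "max C1 C2"], rule exI[of _ 1], intro conjI allI impI)
    show "min c1 c2 > 0" "max C1 C2 > 0" using 1 2 by auto
    fix s :: nat assume s: "1 \<le> s"
    show "min c1 c2 * real s powr (3 / 2) \<le> real (degree_ramsey (cycle_graph 6) s)"
      "real (degree_ramsey (cycle_graph 6) s) \<le> max C1 C2 * real s powr (3 / 2)"
      "min c1 c2 * real s powr (5 / 4) \<le> real (degree_ramsey (cycle_graph 10) s)"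
      "real (degree_ramsey (cycle_graph 10) s) \<le> max C1 C2 * real s powr (5 / 4)"
      using 1(3)[OF s] 2(3)[OF s] by (auto intro!: lo hi)
  qed
qed

end
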